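(* Let $\Gamma$ be a finite quiver, $A=\mathcal{A}_\Gamma$ its path $*$-algebra, $k>1$ an integer, and $L_k\in V_{2k}^*$ a flat truncated functional on $A$. Then $L_k$ has an extension to a linear functional $L$ on $A$ such that $$\operatorname{rank} B_{L_k}=\operatorname{rank} B_L .$$ An extension of $L_k$ to a linear functional on $A$ satisfying this rank equality is unique, and it is positive semidefinite if $L_k$ is positive semidefinite.
   Context: A quiver $\Gamma=(\Gamma_0,\Gamma_1)$ is a directed graph with finite vertex set $\Gamma_0$ and finite arrow set $\Gamma_1$; each arrow $b$ has an origin $o(b)$ and a terminal vertex $t(b)$. The double $\Gamma^*$ has the same vertices and arrows $\Gamma_1\cup\Gamma_1^*$, where $\Gamma_1^*=\{b^*: b\in\Gamma_1\}$ is a disjoint copy of $\Gamma_1$ and $o(b^* )=t(b)$, $t(b^* )=o(b)$. A path in $\Gamma^*$ is a finite sequence of arrows $(b_1,\dots,b_k)$ with $t(b_j)=o(b_{j+1})$; $k$ is its length; for each vertex $e$ there is an empty path of length $0$, also denoted $e$. The path $*$-algebra $\mathcal{A}_\Gamma$ is the complex vector space with basis $\mathcal{B}$ the set of all paths in $\Gamma^*$, with product given by concatenation of paths ($b_1b_2=0$ if $t(b_1)\ne o(b_2)$); its unit is the sum of all vertices. Its involution is the conjugate-linear anti-multiplicative map exchanging $b$ and $b^*$ for $b\in\Gamma_1$ and fixing each vertex $e$. For $k\ge 1$, $V_k$ is the linear span of $S_k=\{a\in\mathcal{B}: |a|\le k\}$ (paths of length at most $k$), and $V_k^*$ is its dual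 space. For $L_k\in V_{2k}^*$ define the sesquilinear form $B_{L_k}\colon V_k\times V_k\to\mathbb{C}$, $B_{L_k}(p,q)=L_k(pq^* )$; for a linear functional $L$ on $A$ define likewise $B_L\colon A\times A\to\mathbb{C}$, $B_L(p,q)=L(pq^* )$. The kernel of such a form $B$ on a space $W$ is $\ker B=\{p\in W: B(p,q)=0\ \text{for all } q\in W\}$, and $\operatorname{rank}B=\dim W/\ker B$. For $k>1$, a functional $L_k\in V_{2k}^*$ is called flat if it is hermitian, i.e. $L_k(a^* )=\overline{L_k(a)}$ for all $a\in V_{2k}$, and $\operatorname{rank}B_{L_k}=\operatorname{rank}B_{L_{k-1}}$, where $L_{k-1}$ is the restriction of $L_k$ to $V_{2k-2}$. $L_k$ (resp. $L$) is positive semidefinite if $L_k(pp^* )\ge 0$ for all $p\in V_k$ (resp. $L(pp^* )\ge0$ for all $p\in A$). *)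

theory Defs
  imports
    "Graph_Theory.Arc_Walk"
    "HOL-Library.Poly_Mapping"
    "HOL-Library.Set_Algebras"
    "HOL-Library.Extended_Nat"
    "HOL-Library.FuncSet"
    "HOL-Library.Complex_Order"
begin

text \<open>
  A finite quiver is a \<^locale>\<open>fin_digraph\<close>: loops and parallel arrows are allowed, the origin and
  the terminal vertex of an arrow are its \<^const>\<open>tail\<close> and \<^const>\<open>head\<close>. In the double,
  \<open>Inl b\<close> is the arrow \<open>b\<close> and \<open>Inr b\<close> is the reversed arrow \<open>b*\<close>.
\<close>

definition double :: "('v, 'e) pre_digraph \<Rightarrow> ('v, 'e + 'e) pre_digraph" where
  "double G = \<lparr>verts = verts G, arcs = arcs G <+> arcs G,
     tail = case_sum (tail G) (head G), head = case_sum (head G) (tail G)\<rparr>"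

text \<open>
  A path is stored together with its end points, \<open>(origin, arrows, end)\<close>, so that the empty paths
  at different vertices are distinct.
\<close>

type_synonym ('v, 'e) qpath = "'v \<times> ('e + 'e) list \<times> 'v"

definition paths :: "('v, 'e) pre_digraph \<Rightarrow> ('v, 'e) qpath set" where
  "paths G = {(u, bs, v). pre_digraph.awalk (double G) u bs v}"

definition path_length :: "('v, 'e) qpath \<Rightarrow> nat" where
  "path_length = (\<lambda>(u, bs, v). length bs)"

definition path_star :: "('v, 'e) qpath \<Rightarrow> ('v, 'e) qpath" where
  "path_star = (\<lambda>(u, bs, v). (v, rev (map (case_sum Inr Inl) bs), u))"

type_synonym ('v, 'e) pvec = "('v, 'e) qpath \<Rightarrow>\<^sub>0 complex"

definition path_prod :: "('v, 'e) qpath \<Rightarrow> ('v, 'e) qpath \<Rightarrow> ('v, 'e) pvec" where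
  "path_prod = (\<lambda>(u, bs, v) (v', cs, w).
     if v = v' then Poly_Mapping.single (u, bs @ cs, w) 1 else 0)"

definition scale :: "complex \<Rightarrow> ('v, 'e) pvec \<Rightarrow> ('v, 'e) pvec" where
  "scale c = Poly_Mapping.map ((*) c)"

lemma lookup_scale: "Poly_Mapping.lookup (scale c p) x = c * Poly_Mapping.lookup p x"
  by (simp add: scale_def Poly_Mapping.map.rep_eq when_def)

global_interpretation pvec: vector_space scale
  by standard (auto intro!: poly_mapping_eqI simp: lookup_scale lookup_add algebra_simps)

definition path_algebra :: "('v, 'e) pre_digraph \<Rightarrow> ('v, 'e) pvec set" where
  "path_algebra G = {p. Poly_Mapping.keys p \<subseteq> paths G}"

definition pvec_mult :: "('v, 'e) pvec \<Rightarrow> ('v, 'e) pvec \<Rightarrow> ('v, 'e) pvec"  (infixl \<open>\<cdot>\<close> 70) where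
  "p \<cdot> q = (\<Sum>x\<in>Poly_Mapping.keys p. \<Sum>y\<in>Poly_Mapping.keys q.
     scale (Poly_Mapping.lookup p x * Poly_Mapping.lookup q y) (path_prod x y))"

definition star :: "('v, 'e) pvec \<Rightarrow> ('v, 'e) pvec" where
  "star p = (\<Sum>x\<in>Poly_Mapping.keys p.
     Poly_Mapping.single (path_star x) (cnj (Poly_Mapping.lookup p x)))"

definition V :: "('v, 'e) pre_digraph \<Rightarrow> nat \<Rightarrow> ('v, 'e) pvec set" where
  "V G k = pvec.span {Poly_Mapping.single x 1 | x. x \<in> paths G \<and> path_length x \<le> k}"

text \<open>
  Linear functionals on a subspace \<open>W\<close>. Extensionality makes equality of functionals mean
  agreement on \<open>W\<close>, and \<^const>\<open>restrict\<close> the restriction to a smaller subspace.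
\<close>

definition dual :: "('v, 'e) pvec set \<Rightarrow> (('v, 'e) pvec \<Rightarrow> complex) set" where
  "dual W = {L \<in> extensional W.
     (\<forall>p\<in>W. \<forall>q\<in>W. L (p + q) = L p + L q) \<and> (\<forall>c. \<forall>p\<in>W. L (scale c p) = c * L p)}"

text \<open>
  The dimension of the quotient \<open>W / K\<close>, whose elements are the cosets \<open>p +o K\<close> with \<open>p \<in> W\<close> and
  whose zero is \<open>K\<close>. Cosets are added and scaled as sets; adding \<open>K\<close> to a linear
  combination corrects the summands with coefficient zero, where scaling gives \<open>{0}\<close> and not
  \<open>K\<close>. The dimension is \<open>\<infinity>\<close> if the quotient is not finite-dimensional.
\<close>

definition quotient_space :: "('v, 'e) pvec set \<Rightarrow> ('v, 'e) pvec set \<Rightarrow> ('v, 'e) pvec set set" where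
  "quotient_space W K = (\<lambda>p. p +o K) ` W"

definition quotient_comb ::
  "('v, 'e) pvec set \<Rightarrow> (('v, 'e) pvec set \<Rightarrow> complex) \<Rightarrow> ('v, 'e) pvec set set \<Rightarrow> ('v, 'e) pvec set" where
  "quotient_comb K c S = K + (\<Sum>X\<in>S. scale (c X) ` X)"

definition quotient_independent :: "('v, 'e) pvec set \<Rightarrow> ('v, 'e) pvec set set \<Rightarrow> bool" where
  "quotient_independent K S \<longleftrightarrow> (\<forall>c. quotient_comb K c S = K \<longrightarrow> (\<forall>X\<in>S. c X = 0))"

definition quotient_dim :: "('v, 'e) pvec set \<Rightarrow> ('v, 'e) pvec set \<Rightarrow> enat" where
  "quotient_dim W K =
     Sup {enat (card S) | S. finite S \<and> S \<subseteq> quotient_space W K \<and> quotient_independent K S}"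

lemma quotient_comb_cosets:
  assumes K: "pvec.subspace K" and "finite S" and "\<And>X. X \<in> S \<Longrightarrow> X = r X +o K"
  shows "quotient_comb K c S = (\<Sum>X\<in>S. scale (c X) (r X)) +o K"
  using assms(2,3)
proof (induction S rule: finite_induct)
  case empty
  then show ?case by (simp add: quotient_comb_def elt_set_plus_def)
next
  case (insert X S)
  have step: "(a +o K) + scale d ` (r X +o K) = (scale d (r X) + a) +o K" for a d
  proof (intro set_eqI iffI)
    fix y assume "y \<in> (a +o K) + scale d ` (r X +o K)"
    then obtain k l where "k \<in> K" "l \<in> K" "y = (a + k) + scale d (r X + l)"
      by (auto simp: set_plus_def elt_set_plus_def)
    then have "y = (scale d (r X) + a) + (k + scale d l)" "k + scale d l \<in> K"
      using K by (auto simp: pvec.scale_right_distrib pvec.subspace_add pvec.subspace_scale algebra_simps)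
    then show "y \<in> (scale d (r X) + a) +o K"
      unfolding elt_set_plus_def by blast
  next
    fix y assume "y \<in> (scale d (r X) + a) +o K"
    then obtain k where k: "k \<in> K" "y = (scale d (r X) + a) + k"
      by (auto simp: elt_set_plus_def)
    have "r X + 0 \<in> r X +o K"
      using pvec.subspace_0[OF K] unfolding elt_set_plus_def by blast
    then have "scale d (r X) \<in> scale d ` (r X +o K)"
      by (simp only: add_0_right imageI)
    moreover have "a + k \<in> a +o K" using k by (auto simp: elt_set_plus_def)
    moreover have "y = (a + k) + scale d (r X)" using k by (simp add: algebra_simps)
    ultimately show "y \<in> (a +o K) + scale d ` (r X +o K)"
      unfolding set_plus_def by blast
  qed
  have "quotient_comb K c (insert X S) = quotient_comb K c S + scale (c X) ` X"
    using insert.hyps by (simp add: quotient_comb_def ac_simps)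
  also have "\<dots> = ((\<Sum>X\<in>S. scale (c X) (r X)) +o K) + scale (c X) ` (r X +o K)"
  proof -
    have "quotient_comb K c S = (\<Sum>X\<in>S. scale (c X) (r X)) +o K"
      by (rule insert.IH) (rule insert.prems, simp)
    moreover have "scale (c X) ` X = scale (c X) ` (r X +o K)"
      by (rule arg_cong[OF insert.prems]) simp
    ultimately show ?thesis by (rule arg_cong2)
  qed
  also have "\<dots> = (\<Sum>X\<in>insert X S. scale (c X) (r X)) +o K"
    using insert.hyps by (simp add: step)
  finally show ?case .
qed

definition form :: "(('v, 'e) pvec \<Rightarrow> complex) \<Rightarrow> ('v, 'e) pvec \<Rightarrow> ('v, 'e) pvec \<Rightarrow> complex" where
  "form L p q = L (p \<cdot> star q)"

definition form_kernel ::
  "(('v, 'e) pvec \<Rightarrow> ('v, 'e) pvec \<Rightarrow> complex) \<Rightarrow> ('v, 'e) pvec set \<Rightarrow> ('v, 'e) pvec set" where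
  "form_kernel B W = {p \<in> W. \<forall>q\<in>W. B p q = 0}"

definition form_rank ::
  "(('v, 'e) pvec \<Rightarrow> ('v, 'e) pvec \<Rightarrow> complex) \<Rightarrow> ('v, 'e) pvec set \<Rightarrow> enat" where
  "form_rank B W = quotient_dim W (form_kernel B W)"

definition hermitian_on :: "('v, 'e) pvec set \<Rightarrow> (('v, 'e) pvec \<Rightarrow> complex) \<Rightarrow> bool" where
  "hermitian_on W L \<longleftrightarrow> (\<forall>a\<in>W. L (star a) = cnj (L a))"

definition flat :: "('v, 'e) pre_digraph \<Rightarrow> nat \<Rightarrow> (('v, 'e) pvec \<Rightarrow> complex) \<Rightarrow> bool" where
  "flat G k L \<longleftrightarrow> hermitian_on (V G (2 * k)) L \<and>
     form_rank (form L) (V G k) = form_rank (form (restrict L (V G (2 * k - 2)))) (V G (k - 1))"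

text \<open>The inequality is that of complex numbers: the value is real and nonnegative.\<close>

definition positive_semidefinite ::
  "('v, 'e) pvec set \<Rightarrow> (('v, 'e) pvec \<Rightarrow> complex) \<Rightarrow> bool" where
  "positive_semidefinite W L \<longleftrightarrow> (\<forall>p\<in>W. 0 \<le> L (p \<cdot> star p))"

definition rank_preserving_extension ::
  "('v, 'e) pre_digraph \<Rightarrow> nat \<Rightarrow> (('v, 'e) pvec \<Rightarrow> complex) \<Rightarrow> (('v, 'e) pvec \<Rightarrow> complex) \<Rightarrow> bool" where
  "rank_preserving_extension G k Lk L \<longleftrightarrow>
     L \<in> dual (path_algebra G) \<and> restrict L (V G (2 * k)) = Lk \<and>
     form_rank (form Lk) (V G k) = form_rank (form L) (path_algebra G)"

end

theory Submission
  imports Defs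
begin

text \<open>
  Write \<open>N\<close> for the kernel of the form of \<open>L\<^sub>k\<close> on \<open>V\<^sub>k\<close>. Flatness amounts to \<open>V\<^sub>k = V\<^sub>k\<^sub>-\<^sub>1 + N\<close>, so there
  is a linear reduction \<open>\<pi>\<close> of \<open>V\<^sub>k\<close> to \<open>V\<^sub>k\<^sub>-\<^sub>1\<close> modulo \<open>N\<close>. Reducing after each arrow,
  \<open>\<phi>(w b) = \<pi>(\<phi>(w) b)\<close>, gives a linear retraction \<open>\<phi>\<close> of the path algebra onto \<open>V\<^sub>k\<^sub>-\<^sub>1\<close>, and the
  extension is \<open>L = L\<^sub>k \<circ> \<phi>\<close>. Since multiplying \<open>N \<inter> V\<^sub>k\<^sub>-\<^sub>1\<close> by an arrow on the right stays in \<open>N\<close>, right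
  multiplication by \<open>a\<close> and by \<open>a*\<close> are adjoint for the form \<open>L\<^sub>k(\<phi>(p) \<phi>(q)*)\<close>, which is therefore the
  form of \<open>L\<close>; this yields the extension property, the rank and positivity. Conversely, equality of the
  ranks forces the kernel of the form of any extension, a right ideal, to contain \<open>N\<close>, hence all
  \<open>p - \<phi>(p)\<close>; this determines the extension.
\<close>

section \<open>Linear algebra on finitely supported functions\<close>

abbreviation basis :: "('v, 'e) qpath \<Rightarrow> ('v, 'e) pvec" where
  "basis x \<equiv> Poly_Mapping.single x 1"

text \<open>Coordinate subspaces. \<open>V G j\<close> and \<open>path_algebra G\<close> are both of
  this form, so linear statements about them reduce to statements about single paths.\<close>

definition supported :: "('v, 'e) qpath set \<Rightarrow> ('v, 'e) pvec set" where
  "supported X = {p. Poly_Mapping.keys p \<subseteq> X}"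

lemma basis_in_supported_iff [simp]: "basis x \<in> supported X \<longleftrightarrow> x \<in> X"
  by (simp add: supported_def)

lemma supported_mono: "X \<subseteq> Y \<Longrightarrow> supported X \<subseteq> supported Y"
  by (auto simp: supported_def)

lemma subspace_supported: "pvec.subspace (supported X)"
  unfolding pvec.subspace_def supported_def
proof safe
  fix p q :: "('a, 'b) pvec" and x
  assume "Poly_Mapping.keys p \<subseteq> X" "Poly_Mapping.keys q \<subseteq> X"
    and "x \<in> Poly_Mapping.keys (p + q)"
  then show "x \<in> X" using keys_add[of p q] by blast
next
  fix c and p :: "('a, 'b) pvec" and x
  assume "Poly_Mapping.keys p \<subseteq> X" "x \<in> Poly_Mapping.keys (scale c p)"
  then show "x \<in> X" by (auto simp: in_keys_iff lookup_scale)
qed auto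

lemma pvec_eq_sum_basis:
  "p = (\<Sum>x\<in>Poly_Mapping.keys p. scale (Poly_Mapping.lookup p x) (basis x))"
proof (rule poly_mapping_eqI)
  fix y
  have "Poly_Mapping.lookup p y =
      (\<Sum>x\<in>Poly_Mapping.keys p. if x = y then Poly_Mapping.lookup p x else 0)"
    by (simp add: in_keys_iff)
  also have "\<dots> = (\<Sum>x\<in>Poly_Mapping.keys p. Poly_Mapping.lookup (scale (Poly_Mapping.lookup p x) (basis x)) y)"
    by (intro sum.cong) (auto simp: lookup_scale lookup_single)
  finally show "Poly_Mapping.lookup p y = Poly_Mapping.lookup
      (\<Sum>x\<in>Poly_Mapping.keys p. scale (Poly_Mapping.lookup p x) (basis x)) y"
    by (simp add: lookup_sum)
qed

lemma supported_induct [consumes 1, case_names zero basis add scale]: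
  assumes "p \<in> supported X" and "P 0" and "\<And>x. x \<in> X \<Longrightarrow> P (basis x)"
    and "\<And>p q. P p \<Longrightarrow> P q \<Longrightarrow> P (p + q)" and "\<And>c p. P p \<Longrightarrow> P (scale c p)"
  shows "P p"
proof -
  have "P (\<Sum>x\<in>S. scale (Poly_Mapping.lookup p x) (basis x))" if "finite S" "S \<subseteq> X" for S
    using that by (induction S rule: finite_induct) (auto intro: assms)
  then show ?thesis using assms(1) by (subst pvec_eq_sum_basis) (auto simp: supported_def)
qed

lemma pvec_induct [case_names zero basis add scale]:
  assumes "P 0" and "\<And>x. P (basis x)"
    and "\<And>p q. P p \<Longrightarrow> P q \<Longrightarrow> P (p + q)" and "\<And>c p. P p \<Longrightarrow> P (scale c p)"
  shows "P p"
  by (rule supported_induct[of p UNIV]) (auto simp: supported_def intro: assms)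

lemma supported_eq_span: "supported X = pvec.span (basis ` X)"
proof
  show "supported X \<subseteq> pvec.span (basis ` X)"
  proof
    fix p assume "p \<in> supported X"
    then show "p \<in> pvec.span (basis ` X)"
      by (induction rule: supported_induct)
        (auto intro: pvec.span_zero pvec.span_base pvec.span_add pvec.span_scale)
  qed
  show "pvec.span (basis ` X) \<subseteq> supported X"
    by (rule pvec.span_minimal) (auto simp: subspace_supported)
qed

definition lin :: "(('v, 'e) qpath \<Rightarrow> ('v, 'e) pvec) \<Rightarrow> ('v, 'e) pvec \<Rightarrow> ('v, 'e) pvec" where
  "lin f p = (\<Sum>x\<in>Poly_Mapping.keys p. scale (Poly_Mapping.lookup p x) (f x))"

lemma lin_superset:
  assumes "finite S" "Poly_Mapping.keys p \<subseteq> S"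
  shows "lin f p = (\<Sum>x\<in>S. scale (Poly_Mapping.lookup p x) (f x))"
  unfolding lin_def using assms
  by (intro sum.mono_neutral_left) (auto simp: in_keys_iff)

lemma lin_zero [simp]: "lin f 0 = 0"
  by (simp add: lin_def)

lemma lin_basis [simp]: "lin f (basis x) = f x"
  by (simp add: lin_def)

lemma lin_add: "lin f (p + q) = lin f p + lin f q"
proof -
  let ?S = "Poly_Mapping.keys p \<union> Poly_Mapping.keys q"
  have "lin f (p + q) = (\<Sum>x\<in>?S. scale (Poly_Mapping.lookup (p + q) x) (f x))"
    by (rule lin_superset) (use keys_add[of p q] in auto)
  also have "\<dots> = (\<Sum>x\<in>?S. scale (Poly_Mapping.lookup p x) (f x)) +
      (\<Sum>x\<in>?S. scale (Poly_Mapping.lookup q x) (f x))"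
    by (simp add: lookup_add pvec.scale_left_distrib sum.distrib)
  also have "\<dots> = lin f p + lin f q"
    by (simp add: lin_superset[of ?S])
  finally show ?thesis .
qed

lemma lin_scale: "lin f (scale c p) = scale c (lin f p)"
proof -
  have "lin f (scale c p) =
      (\<Sum>x\<in>Poly_Mapping.keys p. scale (Poly_Mapping.lookup (scale c p) x) (f x))"
    by (rule lin_superset) (auto simp: in_keys_iff lookup_scale)
  then show ?thesis by (simp add: lookup_scale lin_def pvec.scale_sum_right)
qed

lemma lin_diff: "lin f (p - q) = lin f p - lin f q"
  by (metis add_diff_cancel_right' diff_add_cancel lin_add)

lemma lin_in_subspace:
  assumes "pvec.subspace W" "p \<in> supported X" "\<And>x. x \<in> X \<Longrightarrow> f x \<in> W"
  shows "lin f p \<in> W"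
  using assms(2)
  by (induction rule: supported_induct)
    (auto simp: lin_add lin_scale assms intro: pvec.subspace_0 pvec.subspace_add pvec.subspace_scale)

text \<open>Since \<open>p - lin f p\<close> is linear in \<open>p\<close>, a congruence modulo
  \<open>W\<close> can be checked on paths. The case \<open>W = {0}\<close> shows that
  \<open>lin f\<close> fixes \<open>supported X\<close> once it fixes the paths in
  \<open>X\<close>.\<close>

lemma lin_diff_in_subspace:
  assumes "pvec.subspace W" "p \<in> supported X" "\<And>x. x \<in> X \<Longrightarrow> basis x - f x \<in> W"
  shows "p - lin f p \<in> W"
  using assms(2)
proof (induction rule: supported_induct)
  case (add p q)
  then have "(p - lin f p) + (q - lin f q) \<in> W" by (rule pvec.subspace_add[OF assms(1)])
  then show ?case by (simp add: lin_add algebra_simps)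
next
  case (scale c p)
  then have "scale c (p - lin f p) \<in> W" by (rule pvec.subspace_scale[OF assms(1)])
  then show ?case by (simp add: lin_scale pvec.scale_right_diff_distrib)
qed (auto simp: assms intro: pvec.subspace_0)

abbreviation linear_functional :: "(('v, 'e) pvec \<Rightarrow> complex) \<Rightarrow> bool" where
  "linear_functional \<equiv> module_hom scale (*)"

lemma linear_functionalI:
  assumes "\<And>p q. F (p + q) = F p + F q" "\<And>c p. F (scale c p) = c * F p"
  shows "linear_functional F"
proof -
  have "module ((*) :: complex \<Rightarrow> complex \<Rightarrow> complex)"
    by standard (auto simp: algebra_simps)
  then show ?thesis
    unfolding module_hom_iff using assms pvec.module_axioms by auto
qed

text \<open>Composing \<open>L\<close> with the coordinate projection onto
  \<open>supported X\<close> makes it linear on the whole type, which frees later computations from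
  membership conditions.\<close>

lemma dual_supported_extend:
  assumes "L \<in> dual (supported X)"
  obtains F where "linear_functional F" "\<And>p. p \<in> supported X \<Longrightarrow> L p = F p"
proof
  let ?proj = "lin (\<lambda>x. if x \<in> X then basis x else 0)"
  have mem: "?proj p \<in> supported X" for p
    by (rule lin_in_subspace[of _ _ UNIV])
      (auto simp: subspace_supported pvec.subspace_0 supported_def[of UNIV])
  show "linear_functional (\<lambda>p. L (?proj p))"
    using assms mem by (intro linear_functionalI) (auto simp: dual_def lin_add lin_scale)
  show "L p = L (?proj p)" if "p \<in> supported X" for p
  proof -
    have "p - ?proj p \<in> {0}"
      by (rule lin_diff_in_subspace[OF _ that]) (auto simp: pvec.subspace_def)
    then show ?thesis by simp
  qed
qed

section \<open>Dimensions of quotient spaces\<close>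

text \<open>Independence modulo \<open>K\<close> for a family of representatives instead of a set of
  cosets. For a finite family and a subspace \<open>K\<close> it forces the cosets to be
  distinct.\<close>

definition independent_mod ::
  "('v, 'e) pvec set \<Rightarrow> 'i set \<Rightarrow> ('i \<Rightarrow> ('v, 'e) pvec) \<Rightarrow> bool" where
  "independent_mod K I f \<longleftrightarrow>
     (\<forall>c. (\<Sum>i\<in>I. scale (c i) (f i)) \<in> K \<longrightarrow> (\<forall>i\<in>I. c i = 0))"

lemma independent_modD:
  "independent_mod K I f \<Longrightarrow> (\<Sum>i\<in>I. scale (c i) (f i)) \<in> K \<Longrightarrow> i \<in> I \<Longrightarrow> c i = 0"
  by (auto simp: independent_mod_def)

lemma coset_eq_iff:
  assumes "pvec.subspace K"
  shows "a +o K = b +o K \<longleftrightarrow> a - b \<in> K"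
proof
  assume "a +o K = b +o K"
  moreover have "a + 0 \<in> a +o K"
    using pvec.subspace_0[OF assms] by (rule set_plus_intro2)
  ultimately obtain k where "k \<in> K" "a = b + k"
    by (auto simp: elt_set_plus_def)
  then show "a - b \<in> K" by simp
next
  have *: "a +o K \<subseteq> b +o K" if "a - b \<in> K" for a b
  proof
    fix y assume "y \<in> a +o K"
    then obtain k where "k \<in> K" "y = a + k" by (auto simp: elt_set_plus_def)
    then have "y = b + ((a - b) + k)" "(a - b) + k \<in> K"
      using that assms by (auto simp: pvec.subspace_add)
    then show "y \<in> b +o K" unfolding elt_set_plus_def by blast
  qed
  assume "a - b \<in> K"
  moreover from this have "b - a \<in> K"
    using pvec.subspace_neg[OF assms] by fastforce
  ultimately show "a +o K = b +o K" using * by blast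
qed

lemma coset_eq_self_iff: "pvec.subspace K \<Longrightarrow> a +o K = K \<longleftrightarrow> a \<in> K"
  using coset_eq_iff[of K a 0] by simp

lemma independent_mod_imp_inj_coset:
  assumes "pvec.subspace K" "finite I" "independent_mod K I f"
  shows "inj_on (\<lambda>i. f i +o K) I"
proof (rule inj_onI, rule ccontr)
  fix i j assume ij: "i \<in> I" "j \<in> I" "f i +o K = f j +o K" "i \<noteq> j"
  \<comment> \<open>These coefficients produce \<open>f i - f j\<close>, which lies in
    \<open>K\<close> because the two cosets agree.\<close>
  let ?c = "\<lambda>l. if l = i then 1 else if l = j then - 1 else 0 :: complex"
  have "(\<Sum>l\<in>I. scale (?c l) (f l)) =
      (\<Sum>l\<in>I. (if l = i then f i else 0) + (if l = j then - f j else 0))"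
    using ij(4) by (intro sum.cong) auto
  also have "\<dots> = f i - f j"
    using assms(2) ij by (simp add: sum.distrib)
  finally have "(\<Sum>l\<in>I. scale (?c l) (f l)) \<in> K"
    using ij(3) by (simp add: coset_eq_iff[OF assms(1)])
  from independent_modD[OF assms(3) this ij(1)] show False by simp
qed

text \<open>Distinctness of the cosets makes the family and its set of cosets equally large, so the
  family competes in the supremum that defines \<open>quotient_dim\<close>.\<close>

lemma card_le_quotient_dim:
  assumes K: "pvec.subspace K" and "finite I" "f ` I \<subseteq> W" and ind: "independent_mod K I f"
  shows "enat (card I) \<le> quotient_dim W K"
proof -
  let ?C = "\<lambda>i. f i +o K"
  have inj: "inj_on ?C I" by (rule independent_mod_imp_inj_coset) fact+
  let ?r = "\<lambda>X. f (inv_into I ?C X)"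
  have r: "?r (?C i) = f i" if "i \<in> I" for i
    using inv_into_f_f[OF inj that] by simp
  have "quotient_independent K (?C ` I)"
    unfolding quotient_independent_def
  proof (intro allI impI ballI)
    fix c X assume comb: "quotient_comb K c (?C ` I) = K" and "X \<in> ?C ` I"
    then obtain i where i: "i \<in> I" "X = ?C i" by auto
    have "quotient_comb K c (?C ` I) = (\<Sum>X\<in>?C ` I. scale (c X) (?r X)) +o K"
    proof (rule quotient_comb_cosets[OF K])
      show "X = ?r X +o K" if "X \<in> ?C ` I" for X
        using that r by auto
    qed (simp add: assms)
    also have "(\<Sum>X\<in>?C ` I. scale (c X) (?r X)) = (\<Sum>i\<in>I. scale (c (?C i)) (f i))"
      by (simp add: sum.reindex[OF inj] r)
    finally have "(\<Sum>i\<in>I. scale (c (?C i)) (f i)) +o K = K"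
      by (rule trans[OF sym comb])
    then have "(\<Sum>i\<in>I. scale (c (?C i)) (f i)) \<in> K"
      by (simp only: coset_eq_self_iff[OF K])
    from independent_modD[OF ind this i(1)] show "c X = 0" by (simp add: i)
  qed
  moreover have "?C ` I \<subseteq> quotient_space W K"
    using assms(3) by (auto simp: quotient_space_def)
  ultimately have "enat (card (?C ` I)) \<le> quotient_dim W K"
    unfolding quotient_dim_def using assms(2) by (intro Sup_upper) blast
  then show ?thesis by (simp add: card_image[OF inj])
qed

lemma quotient_independent_representatives:
  assumes K: "pvec.subspace K" and "finite S" "S \<subseteq> quotient_space W K" "quotient_independent K S"
  obtains f where "f ` S \<subseteq> W" "independent_mod K S f"
proof -
  have "\<forall>X\<in>S. \<exists>p\<in>W. X = p +o K"
    using assms(3) by (auto simp: quotient_space_def)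
  then obtain f where f: "\<And>X. X \<in> S \<Longrightarrow> f X \<in> W" "\<And>X. X \<in> S \<Longrightarrow> X = f X +o K"
    by metis
  have "independent_mod K S f"
    unfolding independent_mod_def
  proof (intro allI impI)
    fix c assume "(\<Sum>X\<in>S. scale (c X) (f X)) \<in> K"
    then have "(\<Sum>X\<in>S. scale (c X) (f X)) +o K = K"
      by (simp add: coset_eq_self_iff[OF K])
    moreover have "quotient_comb K c S = (\<Sum>X\<in>S. scale (c X) (f X)) +o K"
      by (rule quotient_comb_cosets[OF K assms(2) f(2)])
    ultimately have "quotient_comb K c S = K" by simp
    then show "\<forall>X\<in>S. c X = 0"
      using assms(4) by (simp add: quotient_independent_def)
  qed
  with f(1) show thesis by (intro that) auto
qed

text \<open>Every independent set of cosets comes from an independent family of representatives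
  indexed by the cosets themselves; hence the index type in the hypothesis.\<close>

lemma quotient_dim_leI:
  assumes "pvec.subspace K"
    and "\<And>(S :: ('v, 'e) pvec set set) f. finite S \<Longrightarrow> f ` S \<subseteq> W \<Longrightarrow> independent_mod K S f \<Longrightarrow>
      enat (card S) \<le> d"
  shows "quotient_dim (W :: ('v, 'e) pvec set) K \<le> d"
  unfolding quotient_dim_def
proof (rule Sup_least)
  fix e assume "e \<in> {enat (card S) | S. finite S \<and> S \<subseteq> quotient_space W K \<and> quotient_independent K S}"
  then obtain S where S: "e = enat (card S)" "finite S" "S \<subseteq> quotient_space W K"
      "quotient_independent K S"
    by blast
  obtain f where "f ` S \<subseteq> W" "independent_mod K S f"
    using quotient_independent_representatives[OF assms(1) S(2-4)] .
  then show "e \<le> d" using assms(2) S(1,2) by simp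
qed

text \<open>A nonempty set of extended naturals with finite supremum is finite and contains its
  maximum; the empty independent set gives nonemptiness.\<close>

lemma quotient_dim_attained:
  fixes W K :: "('v, 'e) pvec set"
  assumes "pvec.subspace K" "quotient_dim W K = enat n"
  obtains S :: "('v, 'e) pvec set set" and f
  where "finite S" "f ` S \<subseteq> W" "independent_mod K S f" "card S = n"
proof -
  let ?D = "{enat (card S) | S. finite S \<and> S \<subseteq> quotient_space W K \<and> quotient_independent K S}"
  have "enat (card {}) \<in> ?D"
    by (rule CollectI, rule exI[of _ "{}"]) (simp add: quotient_independent_def)
  then have ne: "?D \<noteq> {}" by blast
  have Sup: "Sup ?D = enat n"
    using assms(2) by (simp add: quotient_dim_def)
  have "enat n \<in> D" if "D \<noteq> {}" "Sup D = enat n" for D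
  proof -
    have "finite D" "Max D = enat n" using that by (auto simp: Sup_enat_def split: if_splits)
    then show ?thesis using Max_in[of D] that(1) by simp
  qed
  from this[OF ne Sup] have "enat n \<in> ?D" .
  then obtain S where "finite S" "S \<subseteq> quotient_space W K" "quotient_independent K S" "card S = n"
    by auto
  with quotient_independent_representatives[OF assms(1)] that show thesis by metis
qed

text \<open>Combinations of the family stay in \<open>U\<close>, so one that falls into
  \<open>K\<close> lies in \<open>U \<inter> K\<close> and hence in \<open>M\<close>.\<close>

lemma independent_mod_enlarge:
  assumes "pvec.subspace U" "U \<inter> K \<subseteq> M" "f ` I \<subseteq> U" "independent_mod M I f"
  shows "independent_mod K I f"
  unfolding independent_mod_def
proof (intro allI impI)
  fix c assume "(\<Sum>i\<in>I. scale (c i) (f i)) \<in> K"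
  moreover have "(\<Sum>i\<in>I. scale (c i) (f i)) \<in> U"
    using assms(1,3) by (intro pvec.subspace_sum pvec.subspace_scale) auto
  ultimately show "\<forall>i\<in>I. c i = 0"
    using assms(2) independent_modD[OF assms(4)] by blast
qed

lemma quotient_dim_mono:
  assumes "pvec.subspace U" "pvec.subspace M" "pvec.subspace K" "U \<subseteq> W" "U \<inter> K \<subseteq> M"
  shows "quotient_dim U M \<le> quotient_dim W K"
proof (rule quotient_dim_leI[OF assms(2)])
  fix S :: "('a, 'b) pvec set set" and f
  assume S: "finite S" "f ` S \<subseteq> U" "independent_mod M S f"
  from assms(1,5) S(2,3) have "independent_mod K S f" by (rule independent_mod_enlarge)
  moreover have "f ` S \<subseteq> W" using S(2) assms(4) by blast
  ultimately show "enat (card S) \<le> quotient_dim W K"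
    using S(1) assms(3) by (intro card_le_quotient_dim)
qed

text \<open>The second isomorphism theorem at the level of dimensions: each vector of
  \<open>W\<close> may be exchanged modulo \<open>K\<close> for one in \<open>U\<close>, and this
  preserves independence.\<close>

lemma quotient_dim_eq:
  assumes "pvec.subspace U" "pvec.subspace K" "U \<subseteq> W" "\<And>p. p \<in> W \<Longrightarrow> \<exists>u\<in>U. p - u \<in> K"
  shows "quotient_dim W K = quotient_dim U (U \<inter> K)"
proof (rule antisym)
  have UK: "pvec.subspace (U \<inter> K)" using assms by (simp add: pvec.subspace_inter)
  then show "quotient_dim U (U \<inter> K) \<le> quotient_dim W K"
    using assms by (intro quotient_dim_mono) auto
  show "quotient_dim W K \<le> quotient_dim U (U \<inter> K)"
  proof (rule quotient_dim_leI[OF assms(2)])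
    fix S :: "('a, 'b) pvec set set" and f
    assume S: "finite S" "f ` S \<subseteq> W" "independent_mod K S f"
    then have "\<forall>X\<in>S. \<exists>u\<in>U. f X - u \<in> K" using assms(4) by auto
    then obtain g where g: "\<And>X. X \<in> S \<Longrightarrow> g X \<in> U" "\<And>X. X \<in> S \<Longrightarrow> f X - g X \<in> K"
      by metis
    have "independent_mod (U \<inter> K) S g"
      unfolding independent_mod_def
    proof (intro allI impI)
      fix c assume "(\<Sum>X\<in>S. scale (c X) (g X)) \<in> U \<inter> K"
      moreover have "(\<Sum>X\<in>S. scale (c X) (f X - g X)) \<in> K"
        using g(2) by (intro pvec.subspace_sum pvec.subspace_scale assms(2))
      ultimately have "(\<Sum>X\<in>S. scale (c X) (g X)) + (\<Sum>X\<in>S. scale (c X) (f X - g X)) \<in> K"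
        by (intro pvec.subspace_add assms(2)) auto
      then have "(\<Sum>X\<in>S. scale (c X) (f X)) \<in> K"
        by (simp add: pvec.scale_right_diff_distrib sum_subtractf)
      then show "\<forall>X\<in>S. c X = 0" using independent_modD[OF S(3)] by blast
    qed
    with S(1) g(1) UK show "enat (card S) \<le> quotient_dim U (U \<inter> K)"
      by (intro card_le_quotient_dim[of _ _ g]) auto
  qed
qed

text \<open>A largest independent family in \<open>U\<close> modulo \<open>M\<close> stays
  independent modulo \<open>K\<close>, and equality of the finite dimensions forces it to span
  \<open>W\<close> modulo \<open>K\<close>. An element of \<open>M\<close> is congruent modulo
  \<open>K\<close> to a combination of the family; this combination lies in \<open>M\<close>, so its
  coefficients vanish and the element lies in \<open>K\<close>.\<close>

lemma quotient_dim_eq_imp: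
  assumes U: "pvec.subspace U" and M: "pvec.subspace M" and K: "pvec.subspace K"
    and "U \<subseteq> W" "U \<inter> K \<subseteq> M" "M \<subseteq> U"
    and UM: "quotient_dim U M = enat n" and WK: "quotient_dim W K = enat n"
  shows "p \<in> W \<Longrightarrow> \<exists>u\<in>U. p - u \<in> K" and "M \<subseteq> K"
proof -
  obtain S :: "('a, 'b) pvec set set" and f
    where S: "finite S" "f ` S \<subseteq> U" "independent_mod M S f" "card S = n"
    using quotient_dim_attained[OF M UM] .
  have ind: "independent_mod K S f"
    by (rule independent_mod_enlarge[OF U assms(5) S(2,3)])
  have comb_U: "(\<Sum>X\<in>S. scale (c X) (f X)) \<in> U" for c
    using S(2) by (intro pvec.subspace_sum pvec.subspace_scale U) auto
  have ex: "\<exists>c. p - (\<Sum>X\<in>S. scale (c X) (f X)) \<in> K" if "p \<in> W" for p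
  proof (rule ccontr)
    assume none: "\<nexists>c. p - (\<Sum>X\<in>S. scale (c X) (f X)) \<in> K"
    \<comment> \<open>The option type adjoins \<open>p\<close> to the family under the index
      \<open>None\<close>; were the result independent, \<open>n + 1\<close> would bound the
      dimension from below.\<close>
    let ?g = "case_option p f" and ?I = "insert None (Some ` S)"
    have "independent_mod K ?I ?g"
      unfolding independent_mod_def
    proof (intro allI impI)
      fix d assume "(\<Sum>i\<in>?I. scale (d i) (?g i)) \<in> K"
      then have d: "scale (d None) p + (\<Sum>X\<in>S. scale (d (Some X)) (f X)) \<in> K"
        using S(1) by (simp add: sum.reindex)
      have d0: "d None = 0"
      proof (rule ccontr)
        assume nz: "d None \<noteq> 0"
        \<comment> \<open>Dividing by the nonzero coefficient of \<open>p\<close> expresses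
          \<open>p\<close> modulo \<open>K\<close> through the family, which was excluded.\<close>
        from pvec.subspace_scale[OF K d, of "1 / d None"]
        have "p - (\<Sum>X\<in>S. scale (- d (Some X) / d None) (f X)) \<in> K"
          using nz by (simp add: pvec.scale_right_distrib pvec.scale_sum_right sum_negf)
        then have "\<exists>c. p - (\<Sum>X\<in>S. scale (c X) (f X)) \<in> K"
          by (rule exI[of _ "\<lambda>X. - d (Some X) / d None"])
        with none show False by (rule notE)
      qed
      with d have "(\<Sum>X\<in>S. scale (d (Some X)) (f X)) \<in> K" by simp
      with d0 show "\<forall>i\<in>?I. d i = 0"
        using independent_modD[OF ind, of "\<lambda>X. d (Some X)"] by auto
    qed
    moreover have "?g ` ?I \<subseteq> W"
      using S(2) assms(4) that by (auto simp: image_subset_iff)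
    ultimately have "enat (card ?I) \<le> quotient_dim W K"
      using S(1) by (intro card_le_quotient_dim[OF K]) auto
    moreover have "card ?I = Suc n"
      using S(1,4) by (simp add: card_image)
    ultimately show False using WK by simp
  qed
  show "\<exists>u\<in>U. p - u \<in> K" if "p \<in> W" using ex[OF that] comb_U by blast
  show "M \<subseteq> K"
  proof
    fix m assume m: "m \<in> M"
    then obtain c where c: "m - (\<Sum>X\<in>S. scale (c X) (f X)) \<in> K"
      using ex assms(4,6) by blast
    moreover have "m - (\<Sum>X\<in>S. scale (c X) (f X)) \<in> U"
      using m assms(6) comb_U by (intro pvec.subspace_diff U) auto
    ultimately have "m - (\<Sum>X\<in>S. scale (c X) (f X)) \<in> M" using assms(5) by blast
    from pvec.subspace_diff[OF M m this] have "(\<Sum>X\<in>S. scale (c X) (f X)) \<in> M" by simp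
    then have "c X = 0" if "X \<in> S" for X
      using independent_modD[OF S(3)] that by blast
    then show "m \<in> K" using c by simp
  qed
qed

text \<open>A family independent modulo \<open>K\<close> is linearly independent, so the number of
  paths in \<open>X\<close> bounds its size.\<close>

lemma quotient_dim_supported_finite:
  fixes K :: "('v, 'e) pvec set"
  assumes "finite X" "pvec.subspace K"
  obtains n where "quotient_dim (supported X) K = enat n"
proof -
  have "quotient_dim (supported X) K \<le> enat (card (basis ` X))"
  proof (rule quotient_dim_leI[OF assms(2)])
    fix S :: "('v, 'e) pvec set set" and f
    assume S: "finite S" "f ` S \<subseteq> supported X" "independent_mod K S f"
    have inj: "inj_on f S"
      using independent_mod_imp_inj_coset[OF assms(2) S(1,3)] by (auto simp: inj_on_def)
    have "pvec.independent (f ` S)"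
    proof
      assume "pvec.dependent (f ` S)"
      then obtain c s where cs: "s \<in> S" "c (f s) \<noteq> 0" "(\<Sum>v\<in>f ` S. scale (c v) v) = 0"
        using S(1) by (auto simp: pvec.dependent_finite)
      then have "(\<Sum>X\<in>S. scale (c (f X)) (f X)) \<in> K"
        using pvec.subspace_0[OF assms(2)] by (simp add: sum.reindex[OF inj])
      from independent_modD[OF S(3) this cs(1)] cs(2) show False by simp
    qed
    moreover have "f ` S \<subseteq> pvec.span (basis ` X)"
      using S(2) by (simp add: supported_eq_span)
    ultimately have "card (f ` S) \<le> card (basis ` X :: ('v, 'e) pvec set)"
      using pvec.independent_span_bound assms(1) by blast
    then show "enat (card S) \<le> enat (card (basis ` X :: ('v, 'e) pvec set))"
      by (simp add: card_image[OF inj])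
  qed
  then show thesis using that by (cases "quotient_dim (supported X) K") auto
qed

section \<open>The path algebra\<close>

text \<open>The product as an iterated linear extension; bilinearity, and with it the reduction of
  identities to single paths, comes from this form.\<close>

lemma mult_eq_lin: "p \<cdot> q = lin (\<lambda>x. lin (path_prod x) q) p"
  by (simp add: pvec_mult_def lin_def pvec.scale_sum_right)

lemma basis_mult_basis [simp]: "basis x \<cdot> basis y = path_prod x y"
  by (simp add: mult_eq_lin)

lemma mult_zero_left [simp]: "0 \<cdot> q = 0"
  by (simp add: pvec_mult_def)

lemma mult_zero_right [simp]: "p \<cdot> 0 = 0"
  by (simp add: pvec_mult_def)

lemma mult_add_left: "(p + p') \<cdot> q = p \<cdot> q + p' \<cdot> q"
  by (simp add: mult_eq_lin lin_add)

lemma mult_scale_left: "scale c p \<cdot> q = scale c (p \<cdot> q)"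
  by (simp add: mult_eq_lin lin_scale)

lemma mult_add_right: "p \<cdot> (q + q') = p \<cdot> q + p \<cdot> q'"
  by (simp add: mult_eq_lin lin_add) (simp add: lin_def pvec.scale_right_distrib sum.distrib)

lemma mult_scale_right: "p \<cdot> scale c q = scale c (p \<cdot> q)"
  by (simp add: mult_eq_lin lin_scale)
    (simp add: lin_def pvec.scale_sum_right mult.left_commute)

lemma mult_diff_left: "(p - p') \<cdot> q = p \<cdot> q - p' \<cdot> q"
  by (metis add_diff_cancel_right' diff_add_cancel mult_add_left)

lemma mult_diff_right: "p \<cdot> (q - q') = p \<cdot> q - p \<cdot> q'"
  by (metis add_diff_cancel_right' diff_add_cancel mult_add_right)

lemmas mult_linear = mult_add_left mult_add_right mult_scale_left mult_scale_right

lemma mult_assoc: "(p \<cdot> q) \<cdot> r = p \<cdot> (q \<cdot> r)"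
proof (induction p rule: pvec_induct)
  case (basis x)
  show ?case
  proof (induction q rule: pvec_induct)
    case (basis y)
    show ?case
    proof (induction r rule: pvec_induct)
      case (basis z)
      show ?case by (auto simp: path_prod_def split: prod.split)
    qed (auto simp: mult_linear)
  qed (auto simp: mult_linear)
qed (auto simp: mult_linear)

lemma path_star_involution [simp]: "path_star (path_star x) = x"
proof -
  have "case_sum Inr Inl \<circ> case_sum Inr Inl = (id :: 'b + 'b \<Rightarrow> 'b + 'b)"
    by (auto simp: fun_eq_iff split: sum.split)
  then show ?thesis by (simp add: path_star_def rev_map split: prod.split)
qed

text \<open>Only the path \<open>path_star y\<close> contributes, as \<open>path_star\<close> is an
  involution. Conjugate linearity and involutivity of \<open>star\<close> can then be read off
  coefficientwise.\<close>

lemma lookup_star: "Poly_Mapping.lookup (star p) y = cnj (Poly_Mapping.lookup p (path_star y))"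
proof -
  have "Poly_Mapping.lookup (star p) y = (\<Sum>x\<in>Poly_Mapping.keys p.
      if x = path_star y then cnj (Poly_Mapping.lookup p x) else 0)"
    unfolding star_def lookup_sum by (intro sum.cong) (auto simp: lookup_single when_def)
  then show ?thesis by (simp add: in_keys_iff)
qed

lemma star_zero [simp]: "star 0 = 0"
  by (simp add: star_def)

lemma star_add: "star (p + q) = star p + star q"
  by (rule poly_mapping_eqI) (simp add: lookup_star lookup_add)

lemma star_scale: "star (scale c p) = scale (cnj c) (star p)"
  by (rule poly_mapping_eqI) (simp add: lookup_star lookup_scale)

lemma star_diff: "star (p - q) = star p - star q"
  by (rule poly_mapping_eqI) (simp add: lookup_star lookup_minus)

lemma star_star [simp]: "star (star p) = p"
  by (rule poly_mapping_eqI) (simp add: lookup_star)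

lemma star_basis [simp]: "star (basis x) = basis (path_star x)"
  by (simp add: star_def)

lemma star_mult: "star (p \<cdot> q) = star q \<cdot> star p"
proof (induction p rule: pvec_induct)
  case (basis x)
  show ?case
  proof (induction q rule: pvec_induct)
    case (basis y)
    show ?case by (auto simp: path_prod_def path_star_def split: prod.split)
  qed (auto simp: mult_linear star_add star_scale)
qed (auto simp: mult_linear star_add star_scale)

section \<open>Paths of bounded length\<close>

lemma wf_digraph_double:
  assumes "wf_digraph G"
  shows "wf_digraph (double G)"
  using assms by (auto simp: wf_digraph_def double_def)

lemma path_length_simp [simp]: "path_length (u, bs, v) = length bs"
  by (simp add: path_length_def)

lemma path_length_star [simp]: "path_length (path_star x) = path_length x"
  by (simp add: path_star_def split: prod.split)

context wf_digraph
begin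

lemma empty_path_iff [simp]: "(u, [], v) \<in> paths G \<longleftrightarrow> u = v \<and> v \<in> verts G"
  by (auto simp: paths_def pre_digraph.awalk_def pre_digraph.cas.simps double_def)

lemma append_path_iff:
  "(u, bs @ cs, w) \<in> paths G \<longleftrightarrow> (\<exists>v. (u, bs, v) \<in> paths G \<and> (v, cs, w) \<in> paths G)"
proof -
  interpret D: wf_digraph "double G" by (rule wf_digraph_double) unfold_locales
  show ?thesis
    unfolding paths_def by (auto simp: D.awalk_append_iff)
qed

lemma singleton_path_iff:
  "(u, [b], v) \<in> paths G \<longleftrightarrow>
    b \<in> arcs (double G) \<and> u = tail (double G) b \<and> v = head (double G) b"
proof -
  interpret D: wf_digraph "double G" by (rule wf_digraph_double) unfold_locales
  show ?thesis
    unfolding paths_def by (auto simp: D.awalk_def D.cas.simps)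
qed

lemma path_ends:
  assumes "(u, bs, v) \<in> paths G"
  shows "u \<in> verts G" "v \<in> verts G"
  \<comment> \<open>Splitting off an empty path at either end exposes both end points as
    vertices.\<close>
  using append_path_iff[of u "[]" bs v] append_path_iff[of u bs "[]" v] assms by auto

lemma path_star_in_paths: "x \<in> paths G \<Longrightarrow> path_star x \<in> paths G"
proof -
  have "(v, rev (map (case_sum Inr Inl) bs), u) \<in> paths G" if "(u, bs, v) \<in> paths G" for u bs v
    using that
  proof (induction bs arbitrary: u)
    case (Cons b bs)
    then obtain w where w: "(u, [b], w) \<in> paths G" "(w, bs, v) \<in> paths G"
      using append_path_iff[of u "[b]" bs v] by auto
    have "(w, [case_sum Inr Inl b], u) \<in> paths G"
      using w(1) by (cases b) (auto simp: singleton_path_iff double_def)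
    with Cons.IH[OF w(2)] show ?case by (auto simp: append_path_iff)
  qed auto
  then show "x \<in> paths G \<Longrightarrow> path_star x \<in> paths G" by (cases x) (auto simp: path_star_def)
qed

end

definition short_paths :: "('v, 'e) pre_digraph \<Rightarrow> nat \<Rightarrow> ('v, 'e) qpath set" where
  "short_paths G j = {x \<in> paths G. path_length x \<le> j}"

lemma V_eq_supported: "V G j = supported (short_paths G j)"
  unfolding V_def supported_eq_span short_paths_def
  by (rule arg_cong[of _ _ pvec.span]) blast

lemma path_algebra_eq_supported: "path_algebra G = supported (paths G)"
  by (simp add: path_algebra_def supported_def)

lemma subspace_V: "pvec.subspace (V G j)"
  by (simp add: V_eq_supported subspace_supported)

lemma subspace_path_algebra: "pvec.subspace (path_algebra G)"
  by (simp add: path_algebra_eq_supported subspace_supported)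

lemma V_mono: "i \<le> j \<Longrightarrow> V G i \<subseteq> V G j"
  unfolding V_eq_supported by (intro supported_mono) (auto simp: short_paths_def)

lemma V_subset_path_algebra: "V G j \<subseteq> path_algebra G"
  unfolding V_eq_supported path_algebra_eq_supported
  by (intro supported_mono) (auto simp: short_paths_def)

context wf_digraph
begin

lemma V_star: "p \<in> V G j \<Longrightarrow> star p \<in> V G j"
  unfolding V_eq_supported
  by (induction p rule: supported_induct)
    (auto simp: star_add star_scale short_paths_def path_star_in_paths
      intro: subspace_supported[THEN pvec.subspace_0] subspace_supported[THEN pvec.subspace_add]
        subspace_supported[THEN pvec.subspace_scale])

lemma path_algebra_star: "p \<in> path_algebra G \<Longrightarrow> star p \<in> path_algebra G"
  unfolding path_algebra_eq_supported
  by (induction p rule: supported_induct)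
    (auto simp: star_add star_scale path_star_in_paths
      intro: subspace_supported[THEN pvec.subspace_0] subspace_supported[THEN pvec.subspace_add]
        subspace_supported[THEN pvec.subspace_scale])

lemma mult_supported:
  assumes "p \<in> supported X" "q \<in> supported Y"
    and "\<And>u bs v cs w. (u, bs, v) \<in> X \<Longrightarrow> (v, cs, w) \<in> Y \<Longrightarrow> (u, bs @ cs, w) \<in> Z"
  shows "p \<cdot> q \<in> supported Z"
  unfolding mult_eq_lin
proof (rule lin_in_subspace[OF subspace_supported assms(1)],
    rule lin_in_subspace[OF subspace_supported assms(2)])
  fix x y assume "x \<in> X" "y \<in> Y"
  then show "path_prod x y \<in> supported Z"
    using assms(3) pvec.subspace_0[OF subspace_supported]
    by (cases x; cases y) (auto simp: path_prod_def)
qed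

lemma V_mult:
  assumes "p \<in> V G i" "q \<in> V G j"
  shows "p \<cdot> q \<in> V G (i + j)"
  using assms unfolding V_eq_supported
  by (rule mult_supported) (auto simp: short_paths_def append_path_iff)

lemma path_algebra_mult:
  assumes "p \<in> path_algebra G" "q \<in> path_algebra G"
  shows "p \<cdot> q \<in> path_algebra G"
  using assms unfolding path_algebra_eq_supported
  by (rule mult_supported) (auto simp: append_path_iff)

end

context fin_digraph
begin

lemma finite_short_paths: "finite (short_paths G j)"
proof (rule finite_subset)
  let ?A = "arcs G <+> arcs G"
  show "short_paths G j \<subseteq> verts G \<times> {bs. set bs \<subseteq> ?A \<and> length bs \<le> j} \<times> verts G"
  proof
    fix x assume x: "x \<in> short_paths G j"
    obtain u bs v where [simp]: "x = (u, bs, v)" by (cases x)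
    have "(u, bs, v) \<in> paths G" "length bs \<le> j"
      using x by (simp_all add: short_paths_def)
    moreover from this(1) have "set bs \<subseteq> ?A"
      by (simp add: paths_def pre_digraph.awalk_def double_def)
    ultimately show "x \<in> verts G \<times> {bs. set bs \<subseteq> ?A \<and> length bs \<le> j} \<times> verts G"
      by (simp add: path_ends)
  qed
  show "finite (verts G \<times> {bs. set bs \<subseteq> ?A \<and> length bs \<le> j} \<times> verts G)"
    by (intro finite_cartesian_product finite_lists_length_le) auto
qed

definition unit :: "('a, 'b) pvec" where
  "unit = (\<Sum>v\<in>verts G. basis (v, [], v))"

lemma unit_in_V: "unit \<in> V G j"
  unfolding unit_def
  by (intro pvec.subspace_sum subspace_V) (simp add: V_eq_supported short_paths_def)

lemma star_unit [simp]: "star unit = unit"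
proof -
  have "star (\<Sum>v\<in>S. basis (v, [], v)) = (\<Sum>v\<in>S. basis (v, [], v) :: ('a, 'b) pvec)"
    if "finite S" for S :: "'a set"
    using that by (induction S) (auto simp: star_add path_star_def)
  from this[OF finite_verts] show ?thesis by (simp only: unit_def)
qed

lemma mult_unit_right:
  assumes "p \<in> path_algebra G"
  shows "p \<cdot> unit = p"
  using assms unfolding path_algebra_eq_supported
proof (induction rule: supported_induct)
  case (basis x)
  obtain u bs v where x: "x = (u, bs, v)" by (cases x)
  \<comment> \<open>Only the empty path at the end point \<open>v\<close> contributes. A general
    finite \<open>S\<close> makes induction available.\<close>
  have "basis x \<cdot> (\<Sum>w\<in>S. basis (w, [], w)) = (if v \<in> S then basis x else 0)"
    if "finite S" for S
    using that by (induction S) (auto simp: mult_add_right x path_prod_def)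
  then show ?case using basis path_ends x by (auto simp: unit_def)
qed (auto simp: mult_linear)

text \<open>The involution fixes the unit and turns the right unit law into the left one.\<close>

lemma mult_unit_left:
  assumes "p \<in> path_algebra G"
  shows "unit \<cdot> p = p"
  using mult_unit_right[OF path_algebra_star[OF assms]]
  by (metis star_mult star_star star_unit)

end

section \<open>Flat functionals\<close>

declare One_nat_def [simp del]

lemma form_kernel_cong:
  assumes "\<And>p q. p \<in> W \<Longrightarrow> q \<in> W \<Longrightarrow> B p q = B' p q"
  shows "form_kernel B W = form_kernel B' W"
  using assms by (auto simp: form_kernel_def)

lemma linear_functionalD:
  assumes "linear_functional F"
  shows "F 0 = 0" "F (p + q) = F p + F q" "F (scale c p) = c * F p" "F (p - q) = F p - F q"
  using assms module_hom.zero module_hom.add module_hom.scale module_hom.diff by blast+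

lemma subspace_form_kernel:
  assumes "linear_functional F" "pvec.subspace W"
  shows "pvec.subspace (form_kernel (form F) W)"
  using assms(2)
  by (auto simp: pvec.subspace_def form_kernel_def form_def mult_linear linear_functionalD[OF assms(1)])

section \<open>Vertices and arrows as elements of the path algebra\<close>

abbreviation vertex :: "'v \<Rightarrow> ('v, 'e) pvec" where
  "vertex v \<equiv> basis (v, [], v)"

definition arrow :: "('v, 'e) pre_digraph \<Rightarrow> 'e + 'e \<Rightarrow> ('v, 'e) pvec" where
  "arrow G b = basis (tail (double G) b, [b], head (double G) b)"

lemma star_arrow: "star (arrow G b) = arrow G (case_sum Inr Inl b)"
  by (cases b) (simp_all add: arrow_def path_star_def double_def)

lemma arrow_mult_vertex: "arrow G b \<cdot> vertex (head (double G) b) = arrow G b"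
  by (simp add: arrow_def path_prod_def)

context wf_digraph
begin

lemma swapped_arc: "b \<in> arcs (double G) \<Longrightarrow> case_sum Inr Inl b \<in> arcs (double G)"
  by (cases b) (auto simp: double_def)

lemma snoc_path_iff:
  "(u, bs @ [b], v) \<in> paths G \<longleftrightarrow>
    (u, bs, tail (double G) b) \<in> paths G \<and> b \<in> arcs (double G) \<and> v = head (double G) b"
  by (auto simp: append_path_iff singleton_path_iff)

lemma vertex_in_V: "v \<in> verts G \<Longrightarrow> vertex v \<in> V G j"
  by (simp add: V_eq_supported short_paths_def)

lemma arrow_in_V: "b \<in> arcs (double G) \<Longrightarrow> arrow G b \<in> V G 1"
  by (auto simp: V_eq_supported short_paths_def arrow_def singleton_path_iff)

lemma basis_snoc:
  "(u, bs @ [b], v) \<in> paths G \<Longrightarrow>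
    basis (u, bs @ [b], v) = basis (u, bs, tail (double G) b) \<cdot> arrow G b"
  by (auto simp: snoc_path_iff arrow_def path_prod_def)

lemma V_mult_vertex: "p \<in> V G j \<Longrightarrow> v \<in> verts G \<Longrightarrow> p \<cdot> vertex v \<in> V G j"
  using V_mult[of p j "vertex v" 0] by (simp add: vertex_in_V)

lemma V_mult_arrow: "p \<in> V G (k - 1) \<Longrightarrow> 0 < k \<Longrightarrow> b \<in> arcs (double G) \<Longrightarrow> p \<cdot> arrow G b \<in> V G k"
  using V_mult[of p "k - 1" "arrow G b" 1] by (simp add: arrow_in_V)

lemma path_algebra_mult_arrow:
  "p \<in> path_algebra G \<Longrightarrow> b \<in> arcs (double G) \<Longrightarrow> p \<cdot> arrow G b \<in> path_algebra G"
  by (intro path_algebra_mult) (auto simp: path_algebra_eq_supported arrow_def singleton_path_iff)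

end

text \<open>Here \<open>F\<close> stands for a linear extension of the truncated functional to the
  whole type, and the rank equality is replaced by its consequence that \<open>V G k\<close> reduces
  to \<open>V G (k - 1)\<close> modulo the kernel. The link to the ranks is
  \<open>flat_functionalI\<close>.\<close>

locale flat_functional = fin_digraph G for G :: "('v, 'e) pre_digraph" +
  fixes k :: nat and F :: "('v, 'e) pvec \<Rightarrow> complex"
  assumes k_pos: "0 < k"
    and F_linear: "linear_functional F"
    and hermitian: "a \<in> V G (2 * k) \<Longrightarrow> F (star a) = cnj (F a)"
    and flat: "p \<in> V G k \<Longrightarrow> \<exists>u\<in>V G (k - 1). p - u \<in> form_kernel (form F) (V G k)"
begin

lemmas F_simps = linear_functionalD[OF F_linear]

abbreviation ker :: "('v, 'e) pvec set" where
  "ker \<equiv> form_kernel (form F) (V G k)"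

lemma subspace_ker: "pvec.subspace ker"
  by (intro subspace_form_kernel F_linear subspace_V)

lemma ker_subset_V: "ker \<subseteq> V G k"
  by (auto simp: form_kernel_def)

lemma V_pred_subset: "V G (k - 1) \<subseteq> V G k"
  by (rule V_mono) simp

lemma form_hermitian:
  assumes "p \<in> V G k" "q \<in> V G k"
  shows "form F q p = cnj (form F p q)"
proof -
  have "p \<cdot> star q \<in> V G (2 * k)"
    using V_mult[OF assms(1) V_star[OF assms(2)]] by (simp add: mult_2)
  from hermitian[OF this] show ?thesis by (simp add: form_def star_mult)
qed

lemma form_ker_left: "n \<in> ker \<Longrightarrow> q \<in> V G k \<Longrightarrow> form F n q = 0"
  by (simp add: form_kernel_def)

text \<open>The kernel is defined through the first argument; hermitian symmetry makes it a kernel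
  in the second argument too, so that either argument may be changed modulo
  \<open>ker\<close>.\<close>

lemma form_ker_right: "n \<in> ker \<Longrightarrow> p \<in> V G k \<Longrightarrow> form F p n = 0"
  using form_hermitian[of n p] ker_subset_V form_ker_left[of n p] by auto

lemma form_diff_left: "form F (p - p') q = form F p q - form F p' q"
  by (simp add: form_def mult_diff_left F_simps)

lemma form_diff_right: "form F p (q - q') = form F p q - form F p q'"
  by (simp add: form_def mult_diff_right star_diff F_simps)

lemma form_cong_left: "p - p' \<in> ker \<Longrightarrow> q \<in> V G k \<Longrightarrow> form F p q = form F p' q"
  using form_ker_left[of "p - p'" q] by (simp add: form_diff_left)

lemma form_cong_right: "q - q' \<in> ker \<Longrightarrow> p \<in> V G k \<Longrightarrow> form F p q = form F p q'"
  using form_ker_right[of "q - q'" p] by (simp add: form_diff_right)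

text \<open>By flatness every test vector is congruent modulo \<open>ker\<close> to one in
  \<open>V G (k - 1)\<close>. Such a test vector has room for one more arrow.\<close>

lemma kerI:
  assumes "p \<in> V G k" "\<And>q. q \<in> V G (k - 1) \<Longrightarrow> form F p q = 0"
  shows "p \<in> ker"
proof -
  have "form F p q = 0" if q: "q \<in> V G k" for q
  proof -
    obtain u where "u \<in> V G (k - 1)" "q - u \<in> ker" using flat[OF q] by blast
    then show ?thesis using assms form_cong_right[of q u p] by simp
  qed
  with assms(1) show ?thesis by (simp add: form_kernel_def)
qed

lemma ker_mult_vertex:
  assumes "n \<in> ker" "v \<in> verts G"
  shows "n \<cdot> vertex v \<in> ker"
proof (rule kerI)
  show "n \<cdot> vertex v \<in> V G k" using assms ker_subset_V by (intro V_mult_vertex) auto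
  fix q assume "q \<in> V G (k - 1)"
  then have "q \<cdot> vertex v \<in> V G k"
    using assms(2) V_pred_subset by (intro V_mult_vertex) auto
  from form_ker_left[OF assms(1) this] show "form F (n \<cdot> vertex v) q = 0"
    by (simp add: form_def star_mult mult_assoc path_star_def)
qed

text \<open>The arrow moves across the form and becomes its reverse on \<open>q\<close>. As
  \<open>q\<close> may be taken in \<open>V G (k - 1)\<close>, the product is still a test vector in
  \<open>V G k\<close>.\<close>

lemma ker_mult_arrow:
  assumes "n \<in> ker" "n \<in> V G (k - 1)" "b \<in> arcs (double G)"
  shows "n \<cdot> arrow G b \<in> ker"
proof (rule kerI)
  show "n \<cdot> arrow G b \<in> V G k" using assms k_pos by (intro V_mult_arrow)
  fix q assume "q \<in> V G (k - 1)"
  then have "q \<cdot> star (arrow G b) \<in> V G k"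
    unfolding star_arrow using assms(3) k_pos by (intro V_mult_arrow swapped_arc)
  from form_ker_left[OF assms(1) this] show "form F (n \<cdot> arrow G b) q = 0"
    by (simp add: form_def star_mult mult_assoc)
qed

section \<open>The retraction of the path algebra onto \<open>V G (k - 1)\<close>\<close>

definition reduce_path :: "('v, 'e) qpath \<Rightarrow> ('v, 'e) pvec" where
  "reduce_path x = (if x \<in> short_paths G (k - 1) then basis x
     else SOME u. u \<in> V G (k - 1) \<and> basis x - u \<in> ker)"

abbreviation reduce :: "('v, 'e) pvec \<Rightarrow> ('v, 'e) pvec" where
  "reduce \<equiv> lin reduce_path"

lemma reduce_path:
  assumes "x \<in> short_paths G k"
  shows "reduce_path x \<in> V G (k - 1)" "basis x - reduce_path x \<in> ker"
proof -
  have "basis x \<in> V G k" using assms by (simp add: V_eq_supported)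
  then have "\<exists>u. u \<in> V G (k - 1) \<and> basis x - u \<in> ker" using flat by blast
  from someI_ex[OF this]
  show "reduce_path x \<in> V G (k - 1)" "basis x - reduce_path x \<in> ker"
    using pvec.subspace_0[OF subspace_ker] by (auto simp: reduce_path_def V_eq_supported)
qed

lemma reduce_in_V: "p \<in> V G k \<Longrightarrow> reduce p \<in> V G (k - 1)"
  using reduce_path(1) subspace_V unfolding V_eq_supported[of G k] by (rule lin_in_subspace[rotated 2])

lemma diff_reduce_in_ker: "p \<in> V G k \<Longrightarrow> p - reduce p \<in> ker"
  using reduce_path(2) subspace_ker unfolding V_eq_supported[of G k]
  by (intro lin_diff_in_subspace)

text \<open>Short paths are kept as they are instead of being sent to a chosen representative; this
  makes \<open>retract\<close> fix \<open>V G (k - 1)\<close> exactly and not only modulo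
  \<open>ker\<close>.\<close>

lemma reduce_id: "x \<in> short_paths G (k - 1) \<Longrightarrow> reduce (basis x) = basis x"
  by (simp add: reduce_path_def)

definition retract_path :: "('v, 'e) qpath \<Rightarrow> ('v, 'e) pvec" where
  "retract_path = (\<lambda>(u, bs, v). foldl (\<lambda>p b. reduce (p \<cdot> arrow G b)) (vertex u) bs)"

abbreviation retract :: "('v, 'e) pvec \<Rightarrow> ('v, 'e) pvec" where
  "retract \<equiv> lin retract_path"

lemma retract_path_Nil: "retract_path (u, [], v) = vertex u"
  by (simp add: retract_path_def)

lemma retract_path_snoc:
  "retract_path (u, bs @ [b], v) = reduce (retract_path (u, bs, tail (double G) b) \<cdot> arrow G b)"
  by (simp add: retract_path_def)

lemma retract_path_in_V: "(u, bs, v) \<in> paths G \<Longrightarrow> retract_path (u, bs, v) \<in> V G (k - 1)"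
proof (induction bs arbitrary: v rule: rev_induct)
  case (snoc b bs)
  then show ?case
    unfolding retract_path_snoc using k_pos
    by (intro reduce_in_V V_mult_arrow) (auto simp: snoc_path_iff)
qed (auto simp: retract_path_Nil vertex_in_V)

lemma retract_in_V: "p \<in> path_algebra G \<Longrightarrow> retract p \<in> V G (k - 1)"
  unfolding path_algebra_eq_supported
  by (rule lin_in_subspace[OF subspace_V]) (auto intro: retract_path_in_V)

lemma retract_in_Vk: "p \<in> path_algebra G \<Longrightarrow> retract p \<in> V G k"
  using retract_in_V V_pred_subset by blast

text \<open>All prefixes of such a path are short paths as well, and \<open>reduce\<close> fixes
  each of them.\<close>

lemma retract_path_short:
  "(u, bs, v) \<in> paths G \<Longrightarrow> length bs \<le> k - 1 \<Longrightarrow> retract_path (u, bs, v) = basis (u, bs, v)"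
proof (induction bs arbitrary: v rule: rev_induct)
  case (snoc b bs)
  then have "retract_path (u, bs, tail (double G) b) = basis (u, bs, tail (double G) b)"
    by (auto simp: snoc_path_iff)
  then have "retract_path (u, bs @ [b], v) = reduce (basis (u, bs @ [b], v))"
    unfolding retract_path_snoc basis_snoc[OF snoc.prems(1)] by simp
  then show ?case using snoc.prems reduce_id by (simp add: short_paths_def)
qed (auto simp: retract_path_Nil)

lemma retract_id:
  assumes "p \<in> V G (k - 1)"
  shows "retract p = p"
proof -
  have "p - retract p \<in> {0}"
    using assms unfolding V_eq_supported
    by (rule lin_diff_in_subspace[rotated])
      (auto simp: short_paths_def retract_path_short pvec.subspace_def)
  then show ?thesis by simp
qed

text \<open>A path of length at most \<open>k\<close> is changed at most by the reduction after its
  last arrow, since the prefix before it has length at most \<open>k - 1\<close>.\<close>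

lemma diff_retract_in_ker:
  assumes "p \<in> V G k"
  shows "p - retract p \<in> ker"
proof (rule lin_diff_in_subspace[OF subspace_ker])
  show "p \<in> supported (short_paths G k)" using assms by (simp add: V_eq_supported)
  fix x assume "x \<in> short_paths G k"
  moreover obtain u bs v where x: "x = (u, bs, v)" by (cases x)
  ultimately have path: "(u, bs, v) \<in> paths G" "length bs \<le> k" by (auto simp: short_paths_def)
  show "basis x - retract_path x \<in> ker"
  proof (cases bs rule: rev_cases)
    case Nil
    with path show ?thesis
      using pvec.subspace_0[OF subspace_ker] by (simp add: x retract_path_Nil)
  next
    case (snoc cs b)
    with path have cs: "(u, cs, tail (double G) b) \<in> paths G" "length cs \<le> k - 1"
      by (auto simp: snoc_path_iff)
    have "retract_path x = reduce (basis x)"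
      using path(1) unfolding x snoc retract_path_snoc retract_path_short[OF cs]
      by (simp only: basis_snoc)
    moreover have "basis x \<in> V G k" using path by (simp add: x V_eq_supported short_paths_def)
    ultimately show ?thesis using diff_reduce_in_ker[of "basis x"] by simp
  qed
qed

text \<open>
  The choice in \<open>reduce_path\<close> need not respect end points of paths; it does so modulo the kernel.
\<close>

lemma retract_path_mult_end:
  assumes "(u, bs, v) \<in> paths G"
  shows "retract_path (u, bs, v) \<cdot> vertex v - retract_path (u, bs, v) \<in> ker"
proof (cases bs rule: rev_cases)
  case Nil
  then show ?thesis using assms pvec.subspace_0[OF subspace_ker]
    by (simp add: retract_path_Nil path_prod_def)
next
  case (snoc cs b)
  let ?p = "retract_path (u, cs, tail (double G) b) \<cdot> arrow G b"
  have path: "(u, cs, tail (double G) b) \<in> paths G" "b \<in> arcs (double G)" "v = head (double G) b"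
    using assms snoc by (auto simp: snoc_path_iff)
  have "?p \<in> V G k"
    using path k_pos by (intro V_mult_arrow retract_path_in_V)
  then have n: "?p - reduce ?p \<in> ker" by (rule diff_reduce_in_ker)
  \<comment> \<open>As \<open>?p\<close> ends in \<open>v\<close>, multiplication by
    \<open>vertex v\<close> fixes it. What remains of this difference is
    \<open>reduce ?p \<cdot> vertex v - reduce ?p\<close>.\<close>
  have "(?p - reduce ?p) - (?p - reduce ?p) \<cdot> vertex v \<in> ker"
    using pvec.subspace_diff[OF subspace_ker n ker_mult_vertex[OF n path_ends(2)[OF assms]]] .
  moreover have "?p \<cdot> vertex v = ?p"
    unfolding mult_assoc path(3) arrow_mult_vertex ..
  ultimately show ?thesis
    unfolding snoc retract_path_snoc by (simp add: mult_diff_left algebra_simps)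
qed

text \<open>On a path ending in \<open>v\<close> the image \<open>?r\<close> is congruent to
  \<open>?r \<cdot> vertex v\<close>. For \<open>v = w\<close> this is the claim; otherwise
  multiplying the congruence by \<open>vertex w\<close> shows that
  \<open>?r \<cdot> vertex w\<close> lies in \<open>ker\<close>.\<close>

lemma retract_mult_vertex:
  assumes "p \<in> path_algebra G" "w \<in> verts G"
  shows "retract (p \<cdot> vertex w) - retract p \<cdot> vertex w \<in> ker"
  using assms(1) unfolding path_algebra_eq_supported
proof (induction rule: supported_induct)
  case (basis x)
  obtain u bs v where x: "x = (u, bs, v)" by (cases x)
  let ?r = "retract_path (u, bs, v)"
  have n: "?r \<cdot> vertex v - ?r \<in> ker"
    using basis by (intro retract_path_mult_end) (simp add: x)
  show ?case
  proof (cases "v = w")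
    case True
    with pvec.subspace_neg[OF subspace_ker n] show ?thesis by (simp add: x path_prod_def)
  next
    case False
    then have "?r \<cdot> vertex v \<cdot> vertex w = 0" by (simp add: mult_assoc path_prod_def)
    with ker_mult_vertex[OF n assms(2)] False show ?thesis
      by (simp add: x path_prod_def mult_diff_left)
  qed
next
  case (add p q)
  from pvec.subspace_add[OF subspace_ker this] show ?case
    by (simp add: mult_linear lin_add algebra_simps)
next
  case (scale c p)
  from pvec.subspace_scale[OF subspace_ker this, of c] show ?case
    by (simp add: mult_linear lin_scale pvec.scale_right_diff_distrib)
qed (simp add: pvec.subspace_0[OF subspace_ker])

text \<open>If \<open>b\<close> extends the path, the two sides differ by a single reduction.
  Otherwise the path times \<open>b\<close> is zero, and \<open>?r \<cdot> arrow G b\<close> must be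
  shown to lie in \<open>ker\<close>: the element \<open>?r \<cdot> vertex v - ?r\<close> of the
  kernel lies in \<open>V G (k - 1)\<close>, so \<open>ker_mult_arrow\<close> applies to it.\<close>

lemma retract_mult_arrow:
  assumes "p \<in> path_algebra G" "b \<in> arcs (double G)"
  shows "retract (p \<cdot> arrow G b) - retract p \<cdot> arrow G b \<in> ker"
  using assms(1) unfolding path_algebra_eq_supported
proof (induction rule: supported_induct)
  case (basis x)
  obtain u bs v where x: "x = (u, bs, v)" by (cases x)
  let ?r = "retract_path (u, bs, v)"
  have path: "(u, bs, v) \<in> paths G" using basis x by simp
  have rV: "?r \<in> V G (k - 1)" by (rule retract_path_in_V[OF path])
  show ?case
  proof (cases "v = tail (double G) b")
    case True
    then have "retract (basis x \<cdot> arrow G b) = reduce (?r \<cdot> arrow G b)"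
      by (simp add: x arrow_def path_prod_def retract_path_snoc)
    moreover have "?r \<cdot> arrow G b \<in> V G k"
      using rV k_pos assms(2) by (rule V_mult_arrow)
    then have "- (?r \<cdot> arrow G b - reduce (?r \<cdot> arrow G b)) \<in> ker"
      by (intro pvec.subspace_neg subspace_ker diff_reduce_in_ker)
    ultimately show ?thesis by (simp add: x)
  next
    case False
    have "?r \<cdot> vertex v - ?r \<in> V G (k - 1)"
      using rV path_ends(2)[OF path] by (intro pvec.subspace_diff subspace_V V_mult_vertex)
    then have "(?r \<cdot> vertex v - ?r) \<cdot> arrow G b \<in> ker"
      using retract_path_mult_end[OF path] assms(2) by (intro ker_mult_arrow)
    moreover have "?r \<cdot> vertex v \<cdot> arrow G b = 0"
      using False by (simp add: mult_assoc arrow_def path_prod_def)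
    moreover have "basis x \<cdot> arrow G b = 0"
      using False by (simp add: x arrow_def path_prod_def)
    ultimately show ?thesis by (simp add: x mult_diff_left)
  qed
next
  case (add p q)
  from pvec.subspace_add[OF subspace_ker this] show ?case
    by (simp add: mult_linear lin_add algebra_simps)
next
  case (scale c p)
  from pvec.subspace_scale[OF subspace_ker this, of c] show ?case
    by (simp add: mult_linear lin_scale pvec.scale_right_diff_distrib)
qed (simp add: pvec.subspace_0[OF subspace_ker])

section \<open>Adjointness of right multiplication and the form of the extension\<close>

lemma form_retract_vertex:
  assumes "p \<in> path_algebra G" "q \<in> path_algebra G" "v \<in> verts G"
  shows "form F (retract (p \<cdot> vertex v)) (retract q) = form F (retract p) (retract (q \<cdot> vertex v))"
proof -
  have "form F (retract (p \<cdot> vertex v)) (retract q) = form F (retract p \<cdot> vertex v) (retract q)"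
    using assms by (intro form_cong_left retract_mult_vertex retract_in_Vk)
  also have "\<dots> = form F (retract p) (retract q \<cdot> vertex v)"
    by (simp add: form_def star_mult mult_assoc path_star_def)
  also have "\<dots> = form F (retract p) (retract (q \<cdot> vertex v))"
    using assms by (intro form_cong_right[symmetric] retract_mult_vertex retract_in_Vk)
  finally show ?thesis .
qed

text \<open>Modulo \<open>ker\<close> the arrow may be pulled out of the retraction; then it crosses
  the form by associativity and is absorbed into the retraction on the other side.\<close>

lemma form_retract_arrow:
  assumes "p \<in> path_algebra G" "q \<in> path_algebra G" "b \<in> arcs (double G)"
  shows "form F (retract (p \<cdot> arrow G b)) (retract q) =
    form F (retract p) (retract (q \<cdot> star (arrow G b)))"
proof -
  have "form F (retract (p \<cdot> arrow G b)) (retract q) = form F (retract p \<cdot> arrow G b) (retract q)"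
    using assms by (intro form_cong_left retract_mult_arrow retract_in_Vk)
  also have "\<dots> = form F (retract p) (retract q \<cdot> star (arrow G b))"
    by (simp add: form_def star_mult mult_assoc)
  also have "\<dots> = form F (retract p) (retract (q \<cdot> star (arrow G b)))"
    unfolding star_arrow using assms
    by (intro form_cong_right[symmetric] retract_mult_arrow retract_in_Vk swapped_arc)
  finally show ?thesis .
qed

text \<open>Arrows cross the form one at a time, the last one first. Each becomes a factor of the
  second argument, so \<open>q\<close> has to vary in the induction.\<close>

lemma form_retract_path:
  assumes "p \<in> path_algebra G" "q \<in> path_algebra G" "(u, bs, v) \<in> paths G"
  shows "form F (retract (p \<cdot> basis (u, bs, v))) (retract q) =
    form F (retract p) (retract (q \<cdot> star (basis (u, bs, v))))"
  using assms(2,3)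
proof (induction bs arbitrary: q v rule: rev_induct)
  case Nil
  then show ?case using form_retract_vertex[OF assms(1)] by (auto simp: path_star_def)
next
  case (snoc b bs)
  then have path: "(u, bs, tail (double G) b) \<in> paths G" "b \<in> arcs (double G)"
    by (auto simp: snoc_path_iff)
  let ?w = "basis (u, bs, tail (double G) b)"
  have w: "?w \<in> path_algebra G" using path by (simp add: path_algebra_eq_supported)
  have "form F (retract (p \<cdot> ?w \<cdot> arrow G b)) (retract q) =
      form F (retract (p \<cdot> ?w)) (retract (q \<cdot> star (arrow G b)))"
    using assms(1) w snoc.prems(1) path(2) by (intro form_retract_arrow path_algebra_mult)
  also have "\<dots> = form F (retract p) (retract (q \<cdot> star (arrow G b) \<cdot> star ?w))"
    using snoc.prems(1) path unfolding star_arrow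
    by (intro snoc.IH path_algebra_mult_arrow swapped_arc)
  finally show ?case
    unfolding basis_snoc[OF snoc.prems(2)] star_mult mult_assoc .
qed

lemma form_retract:
  assumes "p \<in> path_algebra G" "q \<in> path_algebra G" "a \<in> path_algebra G"
  shows "form F (retract (p \<cdot> a)) (retract q) = form F (retract p) (retract (q \<cdot> star a))"
  using assms(3) unfolding path_algebra_eq_supported
proof (induction a rule: supported_induct)
  case (basis x)
  then show ?case using form_retract_path[OF assms(1,2)] by (cases x) simp
qed (simp_all add: form_def mult_linear lin_add lin_scale star_add star_scale F_simps)

text \<open>The form of the extension is the form of \<open>F\<close> pulled back along
  \<open>retract\<close>. To see this, pair \<open>p \<cdot> star q\<close> with
  \<open>unit\<close>, which \<open>retract\<close> fixes, and move \<open>star q\<close> across by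
  adjointness.\<close>

lemma F_retract_mult:
  assumes "p \<in> path_algebra G" "q \<in> path_algebra G"
  shows "F (retract (p \<cdot> star q)) = form F (retract p) (retract q)"
proof -
  have u: "unit \<in> path_algebra G" using unit_in_V V_subset_path_algebra by blast
  have A: "retract (p \<cdot> star q) \<in> path_algebra G"
    using retract_in_V[OF path_algebra_mult[OF assms(1) path_algebra_star[OF assms(2)]]]
      V_subset_path_algebra by blast
  have "F (retract (p \<cdot> star q)) = form F (retract (p \<cdot> star q)) (retract unit)"
    by (simp add: form_def retract_id[OF unit_in_V] mult_unit_right[OF A])
  also have "\<dots> = form F (retract p) (retract (unit \<cdot> star (star q)))"
    using assms u by (intro form_retract path_algebra_star)
  finally show ?thesis by (simp add: mult_unit_left assms)
qed

text \<open>A path of length at most \<open>2 * k\<close> is cut after \<open>k\<close> arrows. The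
  value on the product is the form of the retracted halves, and each half may be replaced modulo
  \<open>ker\<close> by the original one.\<close>

lemma F_retract_eq:
  assumes "p \<in> V G (2 * k)"
  shows "F (retract p) = F p"
  using assms unfolding V_eq_supported
proof (induction p rule: supported_induct)
  case (basis x)
  obtain u bs v where x: "x = (u, bs, v)" by (cases x)
  then have path: "(u, bs, v) \<in> paths G" "length bs \<le> 2 * k"
    using basis by (auto simp: short_paths_def)
  then obtain w where w: "(u, take k bs, w) \<in> paths G" "(w, drop k bs, v) \<in> paths G"
    using append_path_iff[of u "take k bs" "drop k bs" v] by auto
  \<comment> \<open>The second half is taken with a star because the form stars its second
    argument.\<close>
  let ?y = "basis (u, take k bs, w)" and ?z = "star (basis (w, drop k bs, v))"
  have y: "?y \<in> V G k" using w by (simp add: V_eq_supported short_paths_def)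
  have z: "?z \<in> V G k"
    using w path(2) by (intro V_star) (simp add: V_eq_supported short_paths_def)
  have A: "?y \<in> path_algebra G" "?z \<in> path_algebra G"
    using y z V_subset_path_algebra by blast+
  have yz: "basis x = ?y \<cdot> star ?z"
    by (simp only: star_star basis_mult_basis) (simp add: x path_prod_def)
  have "F (retract (basis x)) = form F (retract ?y) (retract ?z)"
    unfolding yz by (rule F_retract_mult[OF A])
  also have "\<dots> = form F ?y (retract ?z)"
    using y retract_in_Vk[OF A(2)] by (intro form_cong_left[symmetric] diff_retract_in_ker)
  also have "\<dots> = form F ?y ?z"
    using y z by (intro form_cong_right[symmetric] diff_retract_in_ker)
  finally show ?case unfolding yz by (simp add: form_def)
qed (simp_all add: lin_add lin_scale F_simps)

lemma linear_functional_F_retract: "linear_functional (\<lambda>p. F (retract p))"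
  by (intro linear_functionalI) (simp_all add: lin_add lin_scale F_simps)

text \<open>The new form sees its arguments only through \<open>retract\<close>. Hence its kernel
  \<open>?K\<close> meets \<open>V G k\<close> exactly in \<open>ker\<close>, and every
  \<open>p\<close> is congruent to \<open>retract p\<close> modulo \<open>?K\<close>.\<close>

lemma quotient_dim_F_retract:
  "quotient_dim (path_algebra G) (form_kernel (form (\<lambda>p. F (retract p))) (path_algebra G)) =
    quotient_dim (V G k) ker" (is "quotient_dim _ ?K = _")
proof -
  have K: "pvec.subspace ?K"
    by (intro subspace_form_kernel linear_functional_F_retract subspace_path_algebra)
  have form: "form (\<lambda>p. F (retract p)) p q = form F (retract p) (retract q)"
    if "p \<in> path_algebra G" "q \<in> path_algebra G" for p q
    using F_retract_mult[OF that] by (simp add: form_def)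
  have "V G k \<inter> ?K = ker"
  proof (intro set_eqI iffI)
    fix p assume p: "p \<in> V G k \<inter> ?K"
    have "form F p q = 0" if q: "q \<in> V G k" for q
    proof -
      have A: "p \<in> path_algebra G" "q \<in> path_algebra G"
        using p q V_subset_path_algebra by blast+
      have "form F p q = form F (retract p) q"
        using p q by (intro form_cong_left diff_retract_in_ker) auto
      also have "\<dots> = form F (retract p) (retract q)"
        using A q by (intro form_cong_right diff_retract_in_ker retract_in_Vk)
      also have "\<dots> = 0"
        using p A form[OF A] by (auto simp: form_kernel_def)
      finally show ?thesis .
    qed
    with p show "p \<in> ker" by (simp add: form_kernel_def)
  next
    fix p assume p: "p \<in> ker"
    then have pV: "p \<in> V G k" and A: "p \<in> path_algebra G"
      using ker_subset_V V_subset_path_algebra by blast+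
    have "p - (p - retract p) \<in> ker"
      using pvec.subspace_diff[OF subspace_ker p diff_retract_in_ker[OF pV]] .
    then have "retract p \<in> ker" by simp
    then have "form (\<lambda>p. F (retract p)) p q = 0" if "q \<in> path_algebra G" for q
      using form[OF A that] form_ker_left retract_in_Vk[OF that] by simp
    with A pV show "p \<in> V G k \<inter> ?K" by (simp add: form_kernel_def)
  qed
  moreover have "\<exists>u\<in>V G k. p - u \<in> ?K" if p: "p \<in> path_algebra G" for p
  proof (rule bexI)
    show V: "retract p \<in> V G k" by (rule retract_in_Vk[OF p])
    then have A: "p - retract p \<in> path_algebra G"
      using p V_subset_path_algebra by (intro pvec.subspace_diff subspace_path_algebra) auto
    \<comment> \<open>Idempotence of the retraction: \<open>retract p\<close> lies in
      \<open>V G (k - 1)\<close>, where \<open>retract\<close> is the identity.\<close>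
    have "retract (p - retract p) = 0"
      by (simp add: lin_diff retract_id[OF retract_in_V[OF p]])
    then have "form (\<lambda>p. F (retract p)) (p - retract p) q = 0" if "q \<in> path_algebra G" for q
      using form[OF A that] by (simp add: form_def F_simps)
    with A show "p - retract p \<in> ?K" by (simp add: form_kernel_def)
  qed
  then have "quotient_dim (path_algebra G) ?K = quotient_dim (V G k) (V G k \<inter> ?K)"
    by (rule quotient_dim_eq[OF subspace_V K V_subset_path_algebra])
  ultimately show ?thesis by simp
qed

section \<open>Uniqueness of the extension\<close>

lemma quotient_dim_ker_finite: obtains n where "quotient_dim (V G k) ker = enat n"
  using quotient_dim_supported_finite[OF finite_short_paths subspace_ker]
  unfolding V_eq_supported .

lemma extension_unique:
  assumes F': "linear_functional F'" and agree: "\<And>p. p \<in> V G (2 * k) \<Longrightarrow> F' p = F p"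
    and rank: "quotient_dim (path_algebra G) (form_kernel (form F') (path_algebra G)) =
      quotient_dim (V G k) ker"
    and p: "p \<in> path_algebra G"
  shows "F' p = F (retract p)"
proof -
  let ?K = "form_kernel (form F') (path_algebra G)"
  have K: "pvec.subspace ?K"
    by (intro subspace_form_kernel F' subspace_path_algebra)
  have "V G k \<inter> ?K \<subseteq> ker"
  proof
    fix n assume n: "n \<in> V G k \<inter> ?K"
    have "form F n q = 0" if q: "q \<in> V G k" for q
    proof -
      have "n \<cdot> star q \<in> V G (2 * k)"
        using V_mult[OF _ V_star[OF q], of n k] n by (simp add: mult_2)
      then have "form F n q = form F' n q" by (simp add: form_def agree)
      then show ?thesis using n q V_subset_path_algebra by (auto simp: form_kernel_def)
    qed
    with n show "n \<in> ker" by (simp add: form_kernel_def)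
  qed
  moreover obtain d where "quotient_dim (V G k) ker = enat d" by (rule quotient_dim_ker_finite)
  \<comment> \<open>The dimension count in \<open>quotient_dim_eq_imp\<close> reverses the inclusion
    just shown: with equal finite ranks no element of \<open>ker\<close> can escape
    \<open>?K\<close>.\<close>
  ultimately have ker_K: "ker \<subseteq> ?K"
    using rank
    by (intro quotient_dim_eq_imp(2)[OF subspace_V subspace_ker K V_subset_path_algebra
          _ ker_subset_V]) auto
  \<comment> \<open>The kernel of a form on the whole algebra is a right ideal: the factor
    \<open>a\<close> becomes \<open>star a\<close> on the test vector, with no bound on lengths to
    respect.\<close>
  have K_mult: "n \<cdot> a \<in> ?K" if "n \<in> ?K" "a \<in> path_algebra G" for n a
  proof -
    have "F' (n \<cdot> star (q \<cdot> star a)) = 0" if "q \<in> path_algebra G" for q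
      using \<open>n \<in> ?K\<close> path_algebra_mult[OF that path_algebra_star[OF \<open>a \<in> path_algebra G\<close>]]
      by (auto simp: form_kernel_def form_def)
    then show ?thesis
      using that by (auto simp: form_kernel_def form_def star_mult mult_assoc path_algebra_mult)
  qed
  \<comment> \<open>The right ideal property carries the congruence past the next arrow, and the
    error of the subsequent reduction lies in \<open>ker\<close>, hence in
    \<open>?K\<close>.\<close>
  have "basis (u, bs, v) - retract_path (u, bs, v) \<in> ?K" if "(u, bs, v) \<in> paths G" for u bs v
    using that
  proof (induction bs arbitrary: v rule: rev_induct)
    case Nil
    then show ?case using pvec.subspace_0[OF K] by (simp add: retract_path_Nil)
  next
    case (snoc b bs)
    then have path: "(u, bs, tail (double G) b) \<in> paths G" "b \<in> arcs (double G)"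
      by (auto simp: snoc_path_iff)
    let ?w = "(u, bs, tail (double G) b)"
    have arrow: "arrow G b \<in> path_algebra G"
      using arrow_in_V[OF path(2)] V_subset_path_algebra by blast
    have "retract_path ?w \<cdot> arrow G b \<in> V G k"
      using path k_pos by (intro V_mult_arrow retract_path_in_V)
    then have "retract_path ?w \<cdot> arrow G b - reduce (retract_path ?w \<cdot> arrow G b) \<in> ?K"
      using diff_reduce_in_ker ker_K by blast
    from pvec.subspace_add[OF K K_mult[OF snoc.IH[OF path(1)] arrow] this]
    show ?case
      unfolding basis_snoc[OF snoc.prems] retract_path_snoc by (simp add: mult_diff_left)
  qed
  moreover have "p \<in> supported (paths G)" using p by (simp add: path_algebra_eq_supported)
  ultimately have p_diff: "p - retract p \<in> ?K"
    by (intro lin_diff_in_subspace[OF K]) auto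
  \<comment> \<open>Testing against \<open>unit\<close> turns membership in the kernel into equality
    of the values of \<open>F'\<close>.\<close>
  have "unit \<in> path_algebra G" using unit_in_V V_subset_path_algebra by blast
  with p_diff have "F' ((p - retract p) \<cdot> unit) = 0"
    by (auto simp: form_kernel_def form_def)
  moreover have "p - retract p \<in> path_algebra G"
    using p_diff by (simp add: form_kernel_def)
  ultimately have "F' p = F' (retract p)"
    by (simp add: mult_unit_right linear_functionalD[OF F'])
  moreover have "retract p \<in> V G (2 * k)"
    using retract_in_Vk[OF p] V_mono[of k "2 * k"] by auto
  ultimately show ?thesis by (simp add: agree)
qed

end

section \<open>From rank equality to the extension theorem\<close>

lemma flat_functionalI:
  assumes "fin_digraph G" "0 < k" "linear_functional F"
    and "hermitian_on (V G (2 * k)) F"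
    and rank: "form_rank (form F) (V G k) = form_rank (form F) (V G (k - 1))"
  shows "flat_functional G k F"
proof -
  interpret fin_digraph G by fact
  let ?M = "form_kernel (form F) (V G (k - 1))" and ?K = "form_kernel (form F) (V G k)"
  have sub: "V G (k - 1) \<subseteq> V G k" by (rule V_mono) simp
  have M: "pvec.subspace ?M" and K: "pvec.subspace ?K"
    by (intro subspace_form_kernel assms(3) subspace_V)+
  obtain n where n: "quotient_dim (V G k) ?K = enat n"
    using quotient_dim_supported_finite[OF finite_short_paths K] unfolding V_eq_supported .
  have "V G (k - 1) \<inter> ?K \<subseteq> ?M" "?M \<subseteq> V G (k - 1)"
    using sub by (auto simp: form_kernel_def)
  \<comment> \<open>Fewer test vectors only enlarge the kernel, so \<open>V G (k - 1)\<close> modulo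
    \<open>?M\<close> has dimension at most that of \<open>V G k\<close> modulo \<open>?K\<close>.
    Equality of these finite dimensions makes \<open>V G (k - 1)\<close> span modulo
    \<open>?K\<close>.\<close>
  from quotient_dim_eq_imp(1)[OF subspace_V M K sub this _ n] n rank
  have "\<exists>u\<in>V G (k - 1). p - u \<in> ?K" if "p \<in> V G k" for p
    using that by (simp add: form_rank_def)
  with assms(2-4) show ?thesis
    by (intro flat_functional.intro flat_functional_axioms.intro fin_digraph_axioms)
      (simp_all add: hermitian_on_def)
qed

theorem theorem11:
  fixes G :: "('v, 'e) pre_digraph" and k :: nat and Lk :: "('v, 'e) pvec \<Rightarrow> complex"
  assumes "fin_digraph G"
    and "k > 1"
    and "Lk \<in> dual (V G (2 * k))"
    and "flat G k Lk"
  shows "(\<exists>!L. rank_preserving_extension G k Lk L) \<and>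
    (positive_semidefinite (V G k) Lk \<longrightarrow>
      (\<forall>L. rank_preserving_extension G k Lk L \<longrightarrow> positive_semidefinite (path_algebra G) L))"
proof -
  interpret fin_digraph G by fact
  obtain F where F: "linear_functional F" "\<And>p. p \<in> V G (2 * k) \<Longrightarrow> Lk p = F p"
    using dual_supported_extend assms(3) unfolding V_eq_supported by blast
  have form_eq: "form Lk p q = form F p q" if "p \<in> V G k" "q \<in> V G k" for p q
    using V_mult[OF that(1) V_star[OF that(2)]] F(2) by (simp add: form_def mult_2)
  then have ker_eq: "form_kernel (form Lk) (V G k) = form_kernel (form F) (V G k)"
    by (rule form_kernel_cong)
  have "form_kernel (form (restrict Lk (V G (2 * k - 2)))) (V G (k - 1)) =
      form_kernel (form F) (V G (k - 1))"
  proof (rule form_kernel_cong)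
    \<comment> \<open>Products formed from \<open>V G (k - 1)\<close> have length at most
      \<open>2 * k - 2\<close>, so the restriction in the definition of \<open>flat\<close> does not
      change the form.\<close>
    fix p q assume pq: "p \<in> V G (k - 1)" "q \<in> V G (k - 1)"
    have "k - 1 + (k - 1) = 2 * k - 2" using assms(2) by simp
    then have "p \<cdot> star q \<in> V G (2 * k - 2)"
      using V_mult[OF pq(1) V_star[OF pq(2)]] by simp
    moreover have "V G (2 * k - 2) \<subseteq> V G (2 * k)" by (rule V_mono) simp
    ultimately show "form (restrict Lk (V G (2 * k - 2))) p q = form F p q"
      using F(2) by (auto simp: form_def)
  qed
  then have "form_rank (form F) (V G k) = form_rank (form F) (V G (k - 1))"
    using assms(4) by (simp add: flat_def form_rank_def ker_eq)
  moreover have "hermitian_on (V G (2 * k)) F"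
    using assms(4) F(2) V_star by (simp add: flat_def hermitian_on_def)
  ultimately interpret flat_functional G k F
    using assms(1,2) F(1) by (intro flat_functionalI) auto
  \<comment> \<open>Restricting to the algebra supplies the extensionality required by
    \<open>dual\<close>, and with it equality of functionals.\<close>
  let ?L = "restrict (\<lambda>p. F (retract p)) (path_algebra G)"
  have V_A: "p \<in> path_algebra G" if "p \<in> V G j" for p j
    using that V_subset_path_algebra by blast
  have "restrict ?L (V G (2 * k)) = Lk"
    using assms(3) F(2) F_retract_eq V_A
    by (intro extensionalityI[of _ "V G (2 * k)"]) (auto simp: dual_def)
  moreover have "?L \<in> dual (path_algebra G)"
    by (simp add: dual_def lin_add lin_scale F_simps pvec.subspace_add[OF subspace_path_algebra]
        pvec.subspace_scale[OF subspace_path_algebra])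
  moreover have "form_kernel (form ?L) (path_algebra G) =
      form_kernel (form (\<lambda>p. F (retract p))) (path_algebra G)"
    by (rule form_kernel_cong) (simp add: form_def path_algebra_mult path_algebra_star)
  ultimately have ext: "rank_preserving_extension G k Lk ?L"
    by (simp add: rank_preserving_extension_def form_rank_def ker_eq quotient_dim_F_retract)
  \<comment> \<open>Any competitor is first made linear on the whole type, as was done for
    \<open>Lk\<close>, and then compared with \<open>F\<close> on
    \<open>V G (2 * k)\<close>.\<close>
  have unique: "L = ?L" if L: "rank_preserving_extension G k Lk L" for L
  proof (rule extensionalityI)
    have dual: "L \<in> dual (path_algebra G)" and res: "restrict L (V G (2 * k)) = Lk"
      using L by (auto simp: rank_preserving_extension_def)
    obtain F' where F': "linear_functional F'" "\<And>p. p \<in> path_algebra G \<Longrightarrow> L p = F' p"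
      using dual_supported_extend dual unfolding path_algebra_eq_supported by blast
    have "form_kernel (form L) (path_algebra G) = form_kernel (form F') (path_algebra G)"
      by (rule form_kernel_cong) (simp add: form_def F'(2) path_algebra_mult path_algebra_star)
    then have "quotient_dim (path_algebra G) (form_kernel (form F') (path_algebra G)) =
        quotient_dim (V G k) ker"
      using L by (simp add: rank_preserving_extension_def form_rank_def ker_eq)
    moreover have "F' p = F p" if "p \<in> V G (2 * k)" for p
      using fun_cong[OF res, of p] that F(2) F'(2) V_A by simp
    ultimately show "L p = ?L p" if "p \<in> path_algebra G" for p
      using extension_unique[OF F'(1) _ _ that] F'(2) that by simp
    show "L \<in> extensional (path_algebra G)" using dual by (simp add: dual_def)
  qed auto
  have "positive_semidefinite (path_algebra G) ?L" if pos: "positive_semidefinite (V G k) Lk"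
    unfolding positive_semidefinite_def
  proof
    fix p assume p: "p \<in> path_algebra G"
    \<comment> \<open>Each value to be tested is a value of the truncated form at
      \<open>retract p\<close>, where positivity is assumed.\<close>
    have "?L (p \<cdot> star p) = form F (retract p) (retract p)"
      using F_retract_mult[OF p p] p by (simp add: path_algebra_mult path_algebra_star)
    also have "\<dots> = form Lk (retract p) (retract p)"
      using retract_in_Vk[OF p] by (simp add: form_eq)
    finally show "0 \<le> ?L (p \<cdot> star p)"
      using pos retract_in_Vk[OF p] by (simp add: positive_semidefinite_def form_def)
  qed
  with ext unique show ?thesis by metis
qed

end
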